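(* Any subgroup $H$ of $PL_o(I)$ which admits a tall tower contains a subgroup isomorphic to $(\mathbf{Z}\wr)^{\infty}$.
   Context: $PL_o(I)$ is the group of orientation-preserving piecewise-linear homeomorphisms of $I=[0,1]$ with finitely many breaks in slope, acting on the right. An orbital of $g$ is a connected component of the set of points moved by $g$. A signed orbital of $H$ is a pair $(A,g)$, $g\in H$, $A$ an orbital of $g$. A tower of $H$ is a set of signed orbitals of $H$ with pairwise distinct orbitals which are pairwise comparable under inclusion, ordered by inclusion of orbitals. A tower $T$ is tall if there is an order-preserving injection from $\mathbf{N}$ (positive integers) into $T$, i.e. $T$ contains signed orbitals $(A_1,g_1),(A_2,g_2),\ldots$ with $A_1\subsetneq A_2\subsetneq\cdots$. Restricted wreath product: $A\wr\mathbf{Z}=(\bigoplus_{i\in\mathbf{Z}}A)\rtimes\mathbf{Z}$. Let $W_1=\mathbf{Z}$, $W_{k+1}=W_k\wr\mathbf{Z}$ with $W_k$ embedded as the index-$0$ summand of the base; $(\mathbf{Z}\wr)^{\infty}=\ldots((\mathbf{Z}\wr\mathbf{Z})\wr\mathbf{Z})\wr\ldots$ is the ascending union of the $W_k$. *)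

theory Defs
  imports "HOL-Analysis.Analysis" "HOL-Algebra.Group"
begin

definition pl_homeo :: "(real \<Rightarrow> real) \<Rightarrow> bool" where
  "pl_homeo f \<longleftrightarrow>
     continuous_on {0..1} f \<and> strict_mono_on {0..1} f \<and> f 0 = 0 \<and> f 1 = 1 \<and>
     (\<forall>x. x \<notin> {0..1} \<longrightarrow> f x = x) \<and>
     (\<exists>P. finite P \<and> {0,1} \<subseteq> P \<and> P \<subseteq> {0..1} \<and>
        (\<forall>a\<in>P. \<forall>b\<in>P. a < b \<and> {a<..<b} \<inter> P = {} \<longrightarrow>
           (\<exists>m c. \<forall>x\<in>{a..b}. f x = m * x + c)))"

text \<open>Right action: the product g h means first g, then h.\<close>
definition PLo :: "(real \<Rightarrow> real) monoid" where
  "PLo = \<lparr>carrier = {f. pl_homeo f}, mult = (\<lambda>g h. h \<circ> g), one = id\<rparr>"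

definition moved :: "(real \<Rightarrow> real) \<Rightarrow> real set" where
  "moved g = {x \<in> {0..1}. g x \<noteq> x}"

definition orbitals :: "(real \<Rightarrow> real) \<Rightarrow> real set set" where
  "orbitals g = components (moved g)"

definition signed_orbital :: "(real \<Rightarrow> real) set \<Rightarrow> real set \<times> (real \<Rightarrow> real) \<Rightarrow> bool" where
  "signed_orbital H p \<longleftrightarrow> snd p \<in> H \<and> fst p \<in> orbitals (snd p)"

definition tower :: "(real \<Rightarrow> real) set \<Rightarrow> (real set \<times> (real \<Rightarrow> real)) set \<Rightarrow> bool" where
  "tower H T \<longleftrightarrow> (\<forall>p\<in>T. signed_orbital H p) \<and>
     (\<forall>p\<in>T. \<forall>q\<in>T. p \<noteq> q \<longrightarrow> fst p \<noteq> fst q) \<and>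
     (\<forall>p\<in>T. \<forall>q\<in>T. fst p \<subseteq> fst q \<or> fst q \<subseteq> fst p)"

definition tall :: "(real set \<times> (real \<Rightarrow> real)) set \<Rightarrow> bool" where
  "tall T \<longleftrightarrow> (\<exists>s :: nat \<Rightarrow> real set \<times> (real \<Rightarrow> real).
      (\<forall>n. s n \<in> T) \<and> inj s \<and> (\<forall>m n. m \<le> n \<longrightarrow> fst (s m) \<subseteq> fst (s n)))"

datatype wr = WBase int | WPair "int \<Rightarrow> wr" int

definition Zgrp :: "wr monoid" where
  "Zgrp = \<lparr>carrier = range WBase,
           mult = (\<lambda>x y. case x of WBase a \<Rightarrow> (case y of WBase b \<Rightarrow> WBase (a + b) | _ \<Rightarrow> undefined)
                                  | _ \<Rightarrow> undefined),
           one = WBase 0\<rparr>"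

text \<open>Restricted wreath product G wr Z = (direct sum over Z of G) semidirect Z,
  with Z acting on the base by shifting.\<close>
definition wrZ :: "wr monoid \<Rightarrow> wr monoid" where
  "wrZ G = \<lparr>carrier = {WPair f n | f n. (\<forall>i. f i \<in> carrier G) \<and> finite {i. f i \<noteq> \<one>\<^bsub>G\<^esub>}},
           mult = (\<lambda>x y. case x of WPair f n \<Rightarrow>
                       (case y of WPair g m \<Rightarrow> WPair (\<lambda>i. f i \<otimes>\<^bsub>G\<^esub> g (i - n)) (n + m)
                                | _ \<Rightarrow> undefined)
                     | _ \<Rightarrow> undefined),
           one = WPair (\<lambda>i. \<one>\<^bsub>G\<^esub>) 0\<rparr>"

text \<open>Wgrp k is the paper's W_(k+1): Wgrp 0 = Z, Wgrp (k+1) = Wgrp k wr Z.\<close>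
primrec Wgrp :: "nat \<Rightarrow> wr monoid" where
  "Wgrp 0 = Zgrp"
| "Wgrp (Suc k) = wrZ (Wgrp k)"

definition wr_emb :: "nat \<Rightarrow> wr \<Rightarrow> wr" where
  "wr_emb k w = WPair (\<lambda>i. if i = 0 then w else \<one>\<^bsub>Wgrp k\<^esub>) 0"

text \<open>H contains a subgroup isomorphic to the ascending union (direct limit) of the W_k:
  a compatible family of injective homomorphisms W_k \<rightarrow> H (compatible with the
  embeddings W_k \<le> W_(k+1)); the union of their images is such a subgroup.\<close>
definition contains_Zwr_infty :: "(real \<Rightarrow> real) set \<Rightarrow> bool" where
  "contains_Zwr_infty H \<longleftrightarrow>
     (\<exists>\<psi> :: nat \<Rightarrow> wr \<Rightarrow> (real \<Rightarrow> real).
        \<forall>k. \<psi> k \<in> hom (Wgrp k) PLo \<and> inj_on (\<psi> k) (carrier (Wgrp k)) \<and>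
            \<psi> k ` carrier (Wgrp k) \<subseteq> H \<and>
            (\<forall>w\<in>carrier (Wgrp k). \<psi> (Suc k) (wr_emb k w) = \<psi> k w))"

end

theory Submission
  imports Defs
begin

text \<open>Let \<open>L\<close> be generated by the elements of a tall tower. On the orbital of \<open>L\<close> containing the tower the
  commutators have no common fixed point, because every generator has a fixed point there. Call such
  orbitals of \<open>L\<close> full. If the kernel of the action on a set \<open>V\<close> fixes a point of a full orbital \<open>U\<close>,
  then relations valid on \<open>V\<close> hold on a closed invariant subset of \<open>U\<close>; as commuting piecewise linear maps
  fix the ends of each other's orbitals, elements displacing supports on \<open>V\<close> also displace
  them on \<open>U\<close>. This shows that the elements acting trivially on all non-full orbitals still move
  every point of the full ones, and that supports can be displaced on finitely many full orbitals
  at once. Hence there is a sequence in \<open>L\<close> in which every nonzero power of each term displaces the support of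
  its predecessor, and such a sequence generates the iterated wreath product.\<close>

subsection \<open>Piecewise linear maps of the line\<close>

text \<open>Two obstacles shape the argument. A generator that displaces its predecessor must itself
  be displaceable, so its support has to be compact in each orbital of the group. Core elements have
  this property, but they fix every common fixed point of the core and so never displace an interval
  containing one; this is why the non-full orbitals must be killed before the iteration starts.
  Moreover a displacement must succeed on every orbital that the support meets, while one element
  acts on all of them in a correlated way. Here a dichotomy helps: either the kernel of the action
  on the orbitals already treated has no fixed point in the next one and can be used there
  independently, or it has one, and then the action already treated dictates what happens on the new
  orbital. The group may have infinitely many orbitals, but each single element moves points in only
  finitely many of them.\<close>

abbreviation finv :: "(real \<Rightarrow> real) \<Rightarrow> real \<Rightarrow> real" where
  "finv f \<equiv> inv_into UNIV f"

text \<open>Piecewise linearity is encoded by one-sided affine germs, because slopes at fixed points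
  are what gets compared; finiteness reappears through compactness in \<open>finite_ends\<close>.
  The maps live on the whole line, so inverses and compositions carry no domain conditions.\<close>

definition plf :: "(real \<Rightarrow> real) \<Rightarrow> bool" where
  "plf f \<longleftrightarrow> strict_mono f \<and> surj f \<and> continuous_on UNIV f \<and> (\<forall>x. x \<notin> {0<..<1} \<longrightarrow> f x = x) \<and>
     (\<forall>t. \<exists>m. \<forall>\<^sub>F x in at_right t. f x = f t + m * (x - t)) \<and>
     (\<forall>t. \<exists>m. \<forall>\<^sub>F x in at_left t. f x = f t + m * (x - t))"

lemma plf_less: "plf f \<Longrightarrow> f x < f y \<longleftrightarrow> x < y"
  by (simp add: plf_def strict_mono_less)

lemma plf_le: "plf f \<Longrightarrow> f x \<le> f y \<longleftrightarrow> x \<le> y"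
  by (simp add: plf_def strict_mono_less_eq)

lemma plf_eq: "plf f \<Longrightarrow> f x = f y \<longleftrightarrow> x = y"
  by (simp add: plf_def strict_mono_eq)

lemma plf_inj: "plf f \<Longrightarrow> inj f"
  by (simp add: inj_def plf_eq)

lemma plf_bij: "plf f \<Longrightarrow> bij f"
  by (simp add: bij_def plf_inj plf_def)

lemma plf_finv1: "plf f \<Longrightarrow> finv f (f x) = x"
  by (simp add: inv_f_f plf_inj)

lemma plf_finv2: "plf f \<Longrightarrow> f (finv f x) = x"
  by (simp add: plf_def surj_f_inv_f)

lemmas plf_simps = plf_less plf_le plf_eq plf_finv1 plf_finv2

lemma plf_isCont: "plf f \<Longrightarrow> isCont f x"
  by (simp add: plf_def continuous_on_eq_continuous_at)

lemma plf_cont: "plf f \<Longrightarrow> continuous_on A f"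
  unfolding plf_def using continuous_on_subset by blast

lemma closed_fixpoints:
  fixes f :: "real \<Rightarrow> real"
  shows "plf f \<Longrightarrow> closed {t. f t = t}"
  using closed_Collect_eq[OF plf_cont continuous_on_id, of f] by simp

lemma finv_fixpoint: "plf f \<Longrightarrow> finv f t = t \<longleftrightarrow> f t = t"
  by (metis plf_finv1 plf_finv2)

lemma finv_less: "plf f \<Longrightarrow> finv f x < y \<longleftrightarrow> x < f y"
  using plf_less[of f "finv f x" y] by (simp add: plf_finv2)

lemma less_finv: "plf f \<Longrightarrow> x < finv f y \<longleftrightarrow> f x < y"
  using plf_less[of f x "finv f y"] by (simp add: plf_finv2)

lemma funpow_plf_mono: "plf f \<Longrightarrow> (f ^^ n) x < (f ^^ n) y \<longleftrightarrow> x < y"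
  by (induction n) (auto simp: plf_less)

text \<open>An increasing map has no periodic points besides its fixed points: once
  \<open>f t > t\<close> or \<open>f t < t\<close>, all further iterates stay on that side of
  \<open>t\<close>.\<close>

lemma funpow_fixpoint:
  assumes "plf f" shows "(f ^^ Suc n) t = t \<longleftrightarrow> f t = t"
proof
  assume *: "(f ^^ Suc n) t = t"
  have up: "f t > t \<Longrightarrow> (f ^^ Suc k) t > t" for k
    by (induction k) (auto simp: plf_less[OF assms] intro: less_trans)
  have dn: "f t < t \<Longrightarrow> (f ^^ Suc k) t < t" for k
  proof (induction k)
    case (Suc k)
    then have "f ((f ^^ Suc k) t) < f t" by (simp add: plf_less[OF assms])
    then show ?case using Suc by simp
  qed simp
  show "f t = t"
    using up[of n] dn[of n] * by fastforce
next
  assume "f t = t"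
  then show "(f ^^ Suc n) t = t" by (induction n) auto
qed

subsection \<open>Fixed points and orbitals of groups\<close>

definition fixed :: "(real \<Rightarrow> real) set \<Rightarrow> real set" where
  "fixed L = {t. \<forall>f\<in>L. f t = t}"

definition plg :: "(real \<Rightarrow> real) set \<Rightarrow> bool" where
  "plg L \<longleftrightarrow> id \<in> L \<and> (\<forall>f\<in>L. plf f) \<and> (\<forall>f\<in>L. finv f \<in> L) \<and> (\<forall>f\<in>L. \<forall>g\<in>L. f \<circ> g \<in> L)"

definition is_orbital :: "(real \<Rightarrow> real) set \<Rightarrow> real \<Rightarrow> real \<Rightarrow> bool" where
  "is_orbital L a b \<longleftrightarrow> a < b \<and> a \<in> fixed L \<and> b \<in> fixed L \<and> (\<forall>z. a < z \<and> z < b \<longrightarrow> z \<notin> fixed L)"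

lemma plg_plf: "plg L \<Longrightarrow> f \<in> L \<Longrightarrow> plf f"
  and plg_inv: "plg L \<Longrightarrow> f \<in> L \<Longrightarrow> finv f \<in> L"
  and plg_comp: "plg L \<Longrightarrow> f \<in> L \<Longrightarrow> g \<in> L \<Longrightarrow> f \<circ> g \<in> L"
  and plg_id: "plg L \<Longrightarrow> id \<in> L"
  by (auto simp: plg_def)

lemma plg_funpow: "plg L \<Longrightarrow> f \<in> L \<Longrightarrow> f ^^ n \<in> L"
  by (induction n) (auto simp: plg_id plg_comp)

lemma closed_fixed:
  assumes "\<And>f. f \<in> L \<Longrightarrow> plf f" shows "closed (fixed L)"
proof -
  have "fixed L = (\<Inter>f\<in>L. {t. f t = t})" by (auto simp: fixed_def)
  then show ?thesis using closed_fixpoints assms by auto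
qed

lemma orbital_exists:
  assumes L: "\<And>f. f \<in> L \<Longrightarrow> plf f" and q: "q \<notin> fixed L"
  obtains a b where "is_orbital L a b" "a < q" "q < b"
proof -
  let ?F = "fixed L"
  have out: "x \<in> ?F" if "x \<notin> {0<..<1}" for x
    using L that by (auto simp: fixed_def plf_def)
  define a where "a = Sup (?F \<inter> {..q})"
  define b where "b = Inf (?F \<inter> {q..})"
  have "q \<in> {0<..<1}" using out q by blast
  then have ne: "?F \<inter> {..q} \<noteq> {}" "?F \<inter> {q..} \<noteq> {}"
    using out[of 0] out[of 1] by force+
  have cl: "closed (?F \<inter> {..q})" "closed (?F \<inter> {q..})"
    using closed_fixed[OF L] by auto
  have bd: "bdd_above (?F \<inter> {..q})" "bdd_below (?F \<inter> {q..})"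
    by (auto simp: bdd_above_def bdd_below_def)
  have a: "a \<in> ?F \<inter> {..q}" unfolding a_def
    using closed_contains_Sup[OF ne(1) bd(1) cl(1)] .
  have b: "b \<in> ?F \<inter> {q..}" unfolding b_def
    using closed_contains_Inf[OF ne(2) bd(2) cl(2)] .
  have "z \<notin> ?F" if "a < z" "z < b" for z
  proof
    assume "z \<in> ?F"
    show False
    proof (cases "z \<le> q")
      case True
      then have "z \<le> a" unfolding a_def using \<open>z \<in> ?F\<close> bd by (intro cSup_upper) auto
      then show False using that by simp
    next
      case False
      then have "b \<le> z" unfolding b_def using \<open>z \<in> ?F\<close> bd by (intro cInf_lower) auto
      then show False using that by simp
    qed
  qed
  moreover have "a < q" "q < b" using a b q by (force simp: less_le)+
  ultimately show thesis using that[of a b] a b by (auto simp: is_orbital_def)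
qed

lemma orbital_mem:
  assumes "plg L" "is_orbital L a b" "y \<in> L"
  shows "a < y t \<longleftrightarrow> a < t" "y t < b \<longleftrightarrow> t < b"
proof -
  have "y a = a" "y b = b" using assms by (auto simp: is_orbital_def fixed_def)
  then show "a < y t \<longleftrightarrow> a < t" "y t < b \<longleftrightarrow> t < b"
    using plf_less[OF plg_plf[OF assms(1,3)], of a t] plf_less[OF plg_plf[OF assms(1,3)], of t b] by simp_all
qed

lemma orbital_inside:
  assumes "is_orbital L a b" "a < x" "x < b" "is_orbital L c d" "c < x" "x < d"
  shows "a = c \<and> b = d"
proof -
  have "\<not> (c < a \<and> a < d)" "\<not> (c < b \<and> b < d)" "\<not> (a < c \<and> c < b)" "\<not> (a < d \<and> d < b)"
    using assms by (auto simp: is_orbital_def)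
  then show ?thesis using assms by auto
qed

text \<open>If the supremum of the orbit of \<open>z\<close> lay inside the orbital, some element
  would move it to the right, and orbit points close to it would overshoot it.\<close>

lemma far_right:
  assumes N: "plg N" and pl: "is_orbital N a b" and z: "a < z" "z < b" and w: "w < b"
  obtains f where "f \<in> N" "w < f z"
proof (cases "\<exists>f\<in>N. w < f z")
  case False
  then have le: "f z \<le> w" if "f \<in> N" for f using that by (meson not_less)
  define s where "s = Sup ((\<lambda>f. f z) ` N)"
  have ne: "(\<lambda>f. f z) ` N \<noteq> {}" using plg_id[OF N] by auto
  have bd: "bdd_above ((\<lambda>f. f z) ` N)" using le by (auto simp: bdd_above_def)
  have up: "f z \<le> s" if "f \<in> N" for f unfolding s_def using bd that by (intro cSup_upper) auto
  have "s \<le> w" unfolding s_def using ne le by (intro cSup_least) auto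
  moreover have "z \<le> s" using up[OF plg_id[OF N]] by simp
  ultimately have "a < s \<and> s < b" using z w by auto
  then have "s \<notin> fixed N" using pl by (auto simp: is_orbital_def)
  then obtain h0 where h0: "h0 \<in> N" "h0 s \<noteq> s" by (auto simp: fixed_def)
  obtain h where h: "h \<in> N" "s < h s"
  proof (cases "s < h0 s")
    case False
    then have "s < finv h0 s" using h0 less_finv[OF plg_plf[OF N h0(1)]] by auto
    then show ?thesis using that plg_inv[OF N h0(1)] by blast
  qed (use that h0 in blast)
  have "finv h s < s" using h finv_less[OF plg_plf[OF N h(1)]] by auto
  then obtain f where f: "f \<in> N" "finv h s < f z"
    using less_cSup_iff[OF ne bd] unfolding s_def by auto
  then have "s < (h \<circ> f) z" using finv_less[OF plg_plf[OF N h(1)]] by auto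
  then show thesis using up[OF plg_comp[OF N h(1) f(1)]] by simp
qed (use that in blast)

lemma far_left:
  assumes N: "plg N" and pl: "is_orbital N a b" and z: "z < b" and w: "a < w" "w < b"
  obtains f where "f \<in> N" "f z < w"
proof -
  obtain f where "f \<in> N" "z < f w" using far_right[OF N pl w z] .
  then have "finv f z < w" "finv f \<in> N" using finv_less[OF plg_plf[OF N]] plg_inv[OF N] by auto
  then show thesis using that by blast
qed

section \<open>Commutators, germs at common fixed points, and the core\<close>

definition comm :: "(real \<Rightarrow> real) \<Rightarrow> (real \<Rightarrow> real) \<Rightarrow> real \<Rightarrow> real" where
  "comm f g = f \<circ> g \<circ> finv f \<circ> finv g"

lemma comm_in: "plg L \<Longrightarrow> f \<in> L \<Longrightarrow> g \<in> L \<Longrightarrow> comm f g \<in> L"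
  by (simp add: comm_def plg_comp plg_inv)

lemma comm_apply: "plf f \<Longrightarrow> plf g \<Longrightarrow> comm f g (g (f x)) = f (g x)"
  by (simp add: comm_def plf_simps)

text \<open>This plays the role of the derived subgroup: it contains all commutators because
  germs of piecewise linear maps at a common fixed point commute.\<close>
definition core :: "(real \<Rightarrow> real) set \<Rightarrow> (real \<Rightarrow> real) set" where
  "core L = {f \<in> L. \<forall>t\<in>fixed L. \<forall>\<^sub>F x in nhds t. f x = x}"

lemma core_sub: "f \<in> core L \<Longrightarrow> f \<in> L"
  by (simp add: core_def)

lemma nhds_tendsto_fix:
  assumes "plf f" "f t = t" shows "filterlim f (nhds t) (nhds t)"
  using plf_isCont[OF assms(1), of t] assms(2) unfolding isCont_def tendsto_at_iff_tendsto_nhds by simp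

lemma at_right_fix:
  assumes "plf f" "f t = t" shows "filterlim f (at_right t) (at_right t)"
  unfolding filterlim_at
proof
  show "\<forall>\<^sub>F x in at_right t. f x \<in> {t<..} \<and> f x \<noteq> t"
    using eventually_at_right_less[of t]
    by eventually_elim (use plf_less[OF assms(1), of t] assms(2) in auto)
  show "(f \<longlongrightarrow> t) (at_right t)"
    using plf_isCont[OF assms(1), of t] assms(2)
    unfolding isCont_def filterlim_at_split by simp
qed

lemma at_left_fix:
  assumes "plf f" "f t = t" shows "filterlim f (at_left t) (at_left t)"
  unfolding filterlim_at
proof
  have "\<forall>\<^sub>F x in at_left t. x < t" by (simp add: eventually_at_filter)
  then show "\<forall>\<^sub>F x in at_left t. f x \<in> {..<t} \<and> f x \<noteq> t"
    by eventually_elim (use plf_less[OF assms(1), of _ t] assms(2) in auto)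
  show "(f \<longlongrightarrow> t) (at_left t)"
    using plf_isCont[OF assms(1), of t] assms(2)
    unfolding isCont_def filterlim_at_split by simp
qed

text \<open>On each side of \<open>t\<close> both maps multiply the distance to \<open>t\<close> by
  a slope, and slopes commute. The sides are treated separately because slopes may jump at
  \<open>t\<close>.\<close>

lemma germs_commute:
  assumes f: "plf f" "f t = t" and g: "plf g" "g t = t"
  shows "\<forall>\<^sub>F x in nhds t. f (g x) = g (f x)"
proof -
  have gen: "\<forall>\<^sub>F x in F. f (g x) = g (f x)"
    if "\<forall>\<^sub>F x in F. f x = f t + m * (x - t)" "\<forall>\<^sub>F x in F. g x = g t + k * (x - t)"
      "filterlim f F F" "filterlim g F F" for F m k
  proof -
    have "\<forall>\<^sub>F x in F. f (g x) = f t + m * (g x - t)" "\<forall>\<^sub>F x in F. g (f x) = g t + k * (f x - t)"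
      using that by (auto simp: filterlim_iff)
    then show ?thesis using that(1,2)
    proof eventually_elim
      case (elim x)
      have "f (g x) = t + m * (k * (x - t))" unfolding elim(1) unfolding elim(4) using f g by simp
      moreover have "g (f x) = t + k * (m * (x - t))" unfolding elim(2) unfolding elim(3) using f g by simp
      ultimately show ?case by simp
    qed
  qed
  have "\<forall>\<^sub>F x in at_right t. f (g x) = g (f x)"
  proof -
    obtain m where m: "\<forall>\<^sub>F x in at_right t. f x = f t + m * (x - t)" using f(1) unfolding plf_def by blast
    obtain k where k: "\<forall>\<^sub>F x in at_right t. g x = g t + k * (x - t)" using g(1) unfolding plf_def by blast
    show ?thesis by (rule gen[OF m k at_right_fix[OF f] at_right_fix[OF g]])
  qed
  moreover have "\<forall>\<^sub>F x in at_left t. f (g x) = g (f x)"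
  proof -
    obtain m where m: "\<forall>\<^sub>F x in at_left t. f x = f t + m * (x - t)" using f(1) unfolding plf_def by blast
    obtain k where k: "\<forall>\<^sub>F x in at_left t. g x = g t + k * (x - t)" using g(1) unfolding plf_def by blast
    show ?thesis by (rule gen[OF m k at_left_fix[OF f] at_left_fix[OF g]])
  qed
  ultimately have "\<forall>\<^sub>F x in at t. f (g x) = g (f x)" by (simp add: eventually_at_split)
  then show ?thesis using f g by (auto simp: eventually_at_filter elim!: eventually_mono)
qed

lemma comm_core:
  assumes L: "plg L" and f: "f \<in> L" and g: "g \<in> L"
  shows "comm f g \<in> core L"
  unfolding core_def
proof (safe)
  show "comm f g \<in> L" using comm_in[OF assms] .
  fix t assume "t \<in> fixed L"
  then have ht: "h t = t" if "h \<in> L" for h using that by (auto simp: fixed_def)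
  note pf = plg_plf[OF L f] and pg = plg_plf[OF L g]
  have inL: "finv f \<circ> finv g \<in> L" using L f g by (simp add: plg_comp plg_inv)
  have "filterlim (finv f \<circ> finv g) (nhds t) (nhds t)"
    using nhds_tendsto_fix[OF plg_plf[OF L inL] ht[OF inL]] .
  moreover have "\<forall>\<^sub>F x in nhds t. f (g x) = g (f x)"
    using germs_commute[OF pf ht[OF f] pg ht[OF g]] .
  ultimately have "\<forall>\<^sub>F x in nhds t. f (g (finv f (finv g x))) = g (f (finv f (finv g x)))"
    by (auto simp: filterlim_iff)
  then show "\<forall>\<^sub>F x in nhds t. comm f g x = x"
    by eventually_elim (simp add: comm_def plf_finv2[OF pf] plf_finv2[OF pg])
qed

lemma conj_core:
  assumes L: "plg L" and f: "f \<in> core L" and y: "y \<in> L"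
  shows "y \<circ> f \<circ> finv y \<in> core L"
  unfolding core_def
proof (safe)
  show "y \<circ> f \<circ> finv y \<in> L" using L core_sub[OF f] y by (simp add: plg_comp plg_inv)
  fix t assume t: "t \<in> fixed L"
  then have "finv y t = t" using y plg_inv[OF L] by (auto simp: fixed_def)
  then have "filterlim (finv y) (nhds t) (nhds t)"
    using nhds_tendsto_fix[OF plg_plf[OF L plg_inv[OF L y]]] by blast
  moreover have "\<forall>\<^sub>F x in nhds t. f x = x" using f t by (simp add: core_def)
  ultimately have "\<forall>\<^sub>F x in nhds t. f (finv y x) = finv y x" by (auto simp: filterlim_iff)
  then show "\<forall>\<^sub>F x in nhds t. (y \<circ> f \<circ> finv y) x = x"
    by eventually_elim (simp add: plf_finv2[OF plg_plf[OF L y]])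
qed

lemma plg_core:
  assumes L: "plg L" shows "plg (core L)"
  unfolding plg_def
proof (intro conjI ballI)
  show "id \<in> core L" using plg_id[OF L] by (simp add: core_def)
next
  fix f assume f: "f \<in> core L"
  show "plf f" using f L core_sub plg_plf by blast
  show "finv f \<in> core L" unfolding core_def
  proof (safe)
    show "finv f \<in> L" using f core_sub plg_inv[OF L] by blast
    fix t assume "t \<in> fixed L"
    then have "\<forall>\<^sub>F x in nhds t. f x = x" using f by (simp add: core_def)
    then show "\<forall>\<^sub>F x in nhds t. finv f x = x"
      by eventually_elim (simp add: finv_fixpoint[OF \<open>plf f\<close>])
  qed
next
  fix f g assume f: "f \<in> core L" and g: "g \<in> core L"
  show "f \<circ> g \<in> core L" unfolding core_def
  proof (safe)
    show "f \<circ> g \<in> L" using f g core_sub plg_comp[OF L] by blast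
    fix t assume "t \<in> fixed L"
    then have "\<forall>\<^sub>F x in nhds t. f x = x" "\<forall>\<^sub>F x in nhds t. g x = x" using f g by (simp_all add: core_def)
    then show "\<forall>\<^sub>F x in nhds t. (f \<circ> g) x = x" by eventually_elim simp
  qed
qed

text \<open>Both ends of an orbital are common fixed points, so a core element is the identity near
  each of them.\<close>

lemma core_support:
  assumes f: "f \<in> core L" and pl: "is_orbital L a b"
  obtains lo hi where "a < lo" "lo < hi" "hi < b" "\<And>r. a < r \<Longrightarrow> r < b \<Longrightarrow> f r \<noteq> r \<Longrightarrow> lo < r \<and> r < hi"
proof -
  have "\<forall>\<^sub>F x in nhds a. f x = x" "\<forall>\<^sub>F x in nhds b. f x = x"
    using f pl by (auto simp: core_def is_orbital_def)
  then obtain e1 e2 where e: "e1 > 0" "e2 > 0" "\<And>x. dist x a < e1 \<Longrightarrow> f x = x" "\<And>x. dist x b < e2 \<Longrightarrow> f x = x"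
    unfolding eventually_nhds_metric by blast
  have ab: "a < b" using pl by (simp add: is_orbital_def)
  \<comment> \<open>A third of the minimum is strictly below both radii and leaves
    \<open>a + e < b - e\<close>.\<close>
  define e where "e = Min {e1, e2, b - a} / 3"
  have e0: "0 < e" "e < e1" "e < e2" "e \<le> (b - a) / 3" using e ab by (auto simp: e_def)
  have "a + e < r \<and> r < b - e" if "a < r" "r < b" "f r \<noteq> r" for r
  proof (rule conjI; rule ccontr)
    assume "\<not> a + e < r"
    then have "dist r a < e1" using that e0 by (simp add: dist_real_def)
    then show False using e that by blast
  next
    assume "\<not> r < b - e"
    then have "dist r b < e2" using that e0 by (simp add: dist_real_def)
    then show False using e that by blast
  qed
  then show thesis using e0 ab that[of "a+e" "b-e"] by auto
qed


subsection \<open>Orbitals where the core has a fixed point\<close>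

lemma fixed_core_invariant:
  assumes "plg L" "c \<in> fixed (core L)" "y \<in> L"
  shows "y c \<in> fixed (core L)"
  unfolding fixed_def
proof (safe)
  fix f assume "f \<in> core L"
  then have "finv y \<circ> f \<circ> finv (finv y) \<in> core L"
    using conj_core[OF assms(1) _ plg_inv[OF assms(1,3)]] by blast
  then have "(finv y \<circ> f \<circ> finv (finv y)) c = c" using assms by (auto simp: fixed_def)
  moreover have "finv (finv y) = y"
    using plf_bij[OF plg_plf[OF assms(1,3)]] by (simp add: inv_inv_eq)
  ultimately show "f (y c) = y c"
    using plf_finv2[OF plg_plf[OF assms(1,3)]] by (metis comp_apply)
qed

text \<open>Commutators lie in the core, so on the fixed set of the core the group acts as an
  abelian group.\<close>

lemma fixed_core_commute:
  assumes L: "plg L" and c: "c \<in> fixed (core L)" and x: "x \<in> L" and y: "y \<in> L"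
  shows "x (y c) = y (x c)"
proof -
  have "y (x c) \<in> fixed (core L)" using fixed_core_invariant[OF L] c x y by blast
  then have "comm x y (y (x c)) = y (x c)" using comm_core[OF L x y] by (auto simp: fixed_def)
  then show ?thesis using comm_apply[OF plg_plf[OF L x] plg_plf[OF L y]] by simp
qed

text \<open>The witness is the last point of \<open>K\<close> not beyond \<open>e\<close>: both
  \<open>x\<close> and its inverse preserve \<open>K\<close> and the half line ending at
  \<open>e\<close>.\<close>

lemma fixpoint_descends:
  assumes x: "plf x" and cl: "closed K" and inv: "\<And>t. t \<in> K \<Longrightarrow> x t \<in> K" "\<And>t. t \<in> K \<Longrightarrow> finv x t \<in> K"
    and e: "x e = e" and c: "c \<in> K" "c \<le> e"
  obtains p where "p \<in> K" "c \<le> p" "p \<le> e" "x p = p"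
proof -
  define p where "p = Sup (K \<inter> {..e})"
  have ne: "K \<inter> {..e} \<noteq> {}" and bd: "bdd_above (K \<inter> {..e})" using c by (auto simp: bdd_above_def)
  have p: "p \<in> K \<inter> {..e}" unfolding p_def
    using closed_contains_Sup[OF ne bd] cl by auto
  have up: "t \<le> p" if "t \<in> K" "t \<le> e" for t
    unfolding p_def using that bd by (intro cSup_upper) auto
  have "x p \<le> x e" using p plf_le[OF x] by auto
  then have 1: "x p \<le> p" using up inv p e by auto
  have "finv x p \<le> e" using p plf_le[OF x, of "finv x p" e] plf_finv2[OF x] e by auto
  then have "finv x p \<le> p" using up inv p by auto
  then have "x (finv x p) \<le> x p" using plf_le[OF x] by auto
  then have "x p = p" using 1 plf_finv2[OF x] by auto
  then show thesis using that p up[OF c] by auto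
qed

lemma slope_one:
  assumes "(s::real) = t + m * (s - t)" "s \<noteq> t" shows "m = 1"
proof -
  have "m * (s - t) = s - t" using assms(1) by linarith
  then show ?thesis using assms(2) by simp
qed

lemma right_germ_id:
  assumes x: "plf x" and t: "x t = t" and s: "\<And>u. u > t \<Longrightarrow> \<exists>s. t < s \<and> s < u \<and> x s = s"
  shows "\<forall>\<^sub>F s in at_right t. x s = s"
proof -
  obtain m where m: "\<forall>\<^sub>F s in at_right t. x s = x t + m * (s - t)" using x unfolding plf_def by blast
  then obtain u where u: "u > t" "\<And>s. t < s \<Longrightarrow> s < u \<Longrightarrow> x s = x t + m * (s - t)"
    unfolding eventually_at_right_field by blast
  obtain s where "t < s" "s < u" "x s = s" using s[OF u(1)] by blast
  then have "m = 1" using slope_one[of s t m] u(2)[of s] t by simp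
  then show ?thesis using m t by simp
qed

text \<open>The action on the fixed set of the core is abelian, so once \<open>x\<close> fixes a
  point \<open>p\<close> of this set, it fixes the whole orbit of \<open>p\<close>. That orbit
  accumulates at \<open>a\<close>, hence \<open>x\<close> has slope one there and is the identity
  near \<open>a\<close>. Any \<open>c\<close> can be carried into this neighbourhood, and
  commutation brings the conclusion back to \<open>c\<close>.\<close>

lemma fixpoint_spreads:
  assumes L: "plg L" and pl: "is_orbital L a b" and z: "a < z" "z < b" "z \<in> fixed (core L)"
    and x: "x \<in> L" and e: "a < e" "e < b" "x e = e"
    and c: "a < c" "c < b" "c \<in> fixed (core L)"
  shows "x c = c"
proof -
  let ?C = "fixed (core L)"
  note px = plg_plf[OF L x]
  \<comment> \<open>Carrying \<open>z\<close> to the left of \<open>e\<close> lets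
    \<open>fixpoint_descends\<close> find \<open>p\<close> inside the orbital.\<close>
  obtain y0 where y0: "y0 \<in> L" "y0 z < e" using far_left[OF L pl z(2) e(1,2)] .
  have "a < y0 z" using orbital_mem[OF L pl y0(1)] z by simp
  moreover have "y0 z \<in> ?C" using fixed_core_invariant[OF L z(3) y0(1)] .
  moreover have "closed ?C" using closed_fixed plg_plf[OF plg_core[OF L]] by blast
  ultimately obtain p where p: "p \<in> ?C" "a < p" "p \<le> e" "x p = p"
    using fixpoint_descends[OF px, of ?C e "y0 z" thesis] fixed_core_invariant[OF L _ x]
      fixed_core_invariant[OF L _ plg_inv[OF L x]] e(3) y0(2) by force
  have orb: "x (y p) = y p" if "y \<in> L" for y
    using fixed_core_commute[OF L p(1) x that] p by simp
  have "x a = a" using pl x by (auto simp: is_orbital_def fixed_def)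
  have "\<exists>s. a < s \<and> s < u \<and> x s = s" if "a < u" for u
  proof -
    have "a < min u e" "min u e < b" using that e by auto
    moreover have "p < b" using p e by simp
    ultimately obtain y where "y \<in> L" "y p < min u e" using far_left[OF L pl] by blast
    then show ?thesis using orb[of y] orbital_mem[OF L pl \<open>y \<in> L\<close>] p by (intro exI[of _ "y p"]) auto
  qed
  then have "\<forall>\<^sub>F s in at_right a. x s = s"
    using right_germ_id[OF px \<open>x a = a\<close>] by blast
  then obtain u where u: "u > a" "\<And>s. a < s \<Longrightarrow> s < u \<Longrightarrow> x s = s"
    unfolding eventually_at_right_field by blast
  have "a < min u e" "min u e < b" using u(1) e by auto
  then obtain y where y: "y \<in> L" "y c < min u e" using far_left[OF L pl c(2)] by blast
  then have "x (y c) = y c" using u orbital_mem[OF L pl y(1)] c by auto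
  then have "y (x c) = y c" using fixed_core_commute[OF L c(3) x y(1)] by simp
  then show ?thesis using plf_eq[OF plg_plf[OF L y(1)]] by simp
qed

subsection \<open>Commuting on an invariant closed set\<close>

definition ends :: "(real \<Rightarrow> real) \<Rightarrow> real set" where
  "ends f = {t. f t = t \<and> \<not> (\<forall>\<^sub>F s in nhds t. f s = s)}"

text \<open>Infinitely many ends would accumulate at a fixed point \<open>l\<close>. An end close to
  \<open>l\<close> forces slope one on its side of \<open>l\<close>, so the map is the identity
  around that end, which is then no end.\<close>

lemma finite_ends:
  assumes f: "plf f" shows "finite (ends f)"
proof (rule ccontr)
  assume inf: "infinite (ends f)"
  have sub: "ends f \<subseteq> {0..1}"
  proof
    fix t assume t: "t \<in> ends f"
    have "\<forall>\<^sub>F s in nhds t. f s = s" if "t \<in> - {0..1}"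
      by (rule eventually_mono[OF eventually_nhds_in_open[OF _ that]]) (use f in \<open>auto simp: plf_def\<close>)
    then show "t \<in> {0..1}" using t by (auto simp: ends_def)
  qed
  obtain l where l: "l islimpt (ends f)"
    using compact_eq_Bolzano_Weierstrass[of "{0..1::real}"] inf sub by auto
  have "l \<in> {t. f t = t}"
    using closed_fixpoints[OF f] l islimpt_subset[OF l, of "{t. f t = t}"]
    by (auto simp: closed_limpt ends_def)
  then have fl: "f l = l" by simp
  have near: "\<exists>t\<in>ends f. t \<noteq> l \<and> dist t l < e" if "e > 0" for e
    using l that by (auto simp: islimpt_approachable)
  obtain m where "\<forall>\<^sub>F s in at_right l. f s = f l + m * (s - l)" using f unfolding plf_def by blast
  then obtain u where u: "u > l" "\<And>s. l < s \<Longrightarrow> s < u \<Longrightarrow> f s = l + m * (s - l)"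
    unfolding eventually_at_right_field fl by blast
  obtain k where "\<forall>\<^sub>F s in at_left l. f s = f l + k * (s - l)" using f unfolding plf_def by blast
  then obtain v where v: "v < l" "\<And>s. v < s \<Longrightarrow> s < l \<Longrightarrow> f s = l + k * (s - l)"
    unfolding eventually_at_left_field fl by blast
  obtain t where t: "t \<in> ends f" "t \<noteq> l" "dist t l < min (u - l) (l - v)"
    using near[of "min (u - l) (l - v)"] u v by auto
  have ft: "f t = t" using t by (simp add: ends_def)
  show False
  proof (cases "l < t")
    case True
    then have tt: "t \<in> {l<..<u}" using t by (auto simp: dist_real_def)
    then have "m = 1" using slope_one[of t l m] u(2)[of t] ft by simp
    have "\<forall>\<^sub>F s in nhds t. f s = s"
      by (rule eventually_mono[OF eventually_nhds_in_open[OF _ tt]]) (use u(2) \<open>m = 1\<close> in auto)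
    then show False using t by (simp add: ends_def)
  next
    case False
    then have tt: "t \<in> {v<..<l}" using t by (auto simp: dist_real_def)
    then have "k = 1" using slope_one[of t l k] v(2)[of t] ft by simp
    have "\<forall>\<^sub>F s in nhds t. f s = s"
      by (rule eventually_mono[OF eventually_nhds_in_open[OF _ tt]]) (use v(2) \<open>k = 1\<close> in auto)
    then show False using t by (simp add: ends_def)
  qed
qed

text \<open>Every iterate of \<open>d\<close> under \<open>g\<close> is again an end of \<open>f\<close>, and there are only finitely many of those.\<close>
lemma commuting_fixes_end:
  assumes f: "plf f" and g: "plf g" and K: "closed K"
    and fK: "\<And>t. t \<in> K \<Longrightarrow> f t \<in> K" "\<And>t. t \<in> K \<Longrightarrow> finv f t \<in> K" and gK: "\<And>t. t \<in> K \<Longrightarrow> g t \<in> K"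
    and com: "\<And>t. t \<in> K \<Longrightarrow> f (g t) = g (f t)"
    and p: "p \<in> K" "d < p" and d: "f d = d" "\<And>t. d < t \<Longrightarrow> t \<le> p \<Longrightarrow> f t \<noteq> t"
  shows "g d = d"
proof -
  let ?S = "K \<inter> {d<..p}"
  have ne: "?S \<noteq> {}" using p by auto
  have bd: "bdd_below ?S" by (rule bdd_belowI[of _ d]) auto
  define s where "s = Inf ?S"
  have low: "s \<le> t" if "t \<in> ?S" for t unfolding s_def using that bd by (intro cInf_lower) auto
  have near: "\<exists>t\<in>?S. t < u" if "s < u" for u
    using that cInf_less_iff[OF ne bd] unfolding s_def by blast
  have "d \<le> s" unfolding s_def using ne by (intro cInf_greatest) auto
  have clos: "s \<in> K" unfolding s_def
    by (rule closed_subset_contains_Inf[OF K _ ne bd]) simp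
  \<comment> \<open>A larger infimum would be brought closer to \<open>d\<close>, within
    \<open>K\<close>, by \<open>f\<close> or its inverse. So \<open>K\<close> accumulates at
    \<open>d\<close> from the right.\<close>
  have "s = d"
  proof (rule ccontr)
    assume "s \<noteq> d"
    then have "d < s" using \<open>d \<le> s\<close> by simp
    have "s \<le> p" using low p by auto
    then have "f s \<noteq> s" using d \<open>d < s\<close> by auto
    then consider "f s < s" | "finv f s < s" using finv_less[OF f] by fastforce
    then show False
    proof cases
      case 1
      moreover have "d < f s" using plf_less[OF f, of d s] d \<open>d < s\<close> by simp
      ultimately show False using low[of "f s"] fK(1)[OF clos] \<open>s \<le> p\<close> by auto
    next
      case 2
      moreover have "d < finv f s" using less_finv[OF f, of d s] d \<open>d < s\<close> by simp
      ultimately show False using low[of "finv f s"] fK(2)[OF clos] \<open>s \<le> p\<close> by auto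
    qed
  qed
  have gnK: "(g ^^ n) t \<in> K" if "t \<in> K" for n t
    using that gK by (induction n) auto
  have comn: "f ((g ^^ n) t) = (g ^^ n) (f t)" if "t \<in> K" for n t
    using that gnK com by (induction n) auto
  \<comment> \<open>Points of \<open>K\<close> close to \<open>d\<close> are moved by
    \<open>f\<close>; by commutation so are their images under \<open>g ^^ n\<close>, and these
    approach \<open>(g ^^ n) d\<close>.\<close>
  have "(g ^^ n) d \<in> ends f" for n
    unfolding ends_def
  proof (safe)
    show "f ((g ^^ n) d) = (g ^^ n) d" using comn clos \<open>s = d\<close> d by simp
    assume "\<forall>\<^sub>F s in nhds ((g ^^ n) d). f s = s"
    moreover have "filterlim (g ^^ n) (nhds ((g ^^ n) d)) (nhds d)"
    proof -
      have "isCont (g ^^ n) d"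
      proof (induction n)
        case (Suc n)
        then show ?case using continuous_at_compose[OF Suc plf_isCont[OF g]] by (simp only: funpow.simps)
      qed (simp add: id_def)
      then show ?thesis unfolding isCont_def tendsto_at_iff_tendsto_nhds .
    qed
    ultimately have "\<forall>\<^sub>F s in nhds d. f ((g ^^ n) s) = (g ^^ n) s" by (auto simp: filterlim_iff)
    then obtain e where e: "e > 0" "\<And>s. dist s d < e \<Longrightarrow> f ((g ^^ n) s) = (g ^^ n) s"
      unfolding eventually_nhds_metric by blast
    obtain t where t: "t \<in> ?S" "t < d + e" using near[of "d + e"] e \<open>s = d\<close> by auto
    then have "f ((g ^^ n) t) = (g ^^ n) t" using e(2)[of t] by (auto simp: dist_real_def)
    then have "(g ^^ n) (f t) = (g ^^ n) t" using comn t by simp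
    then have "f t = t" using funpow_plf_mono[OF g, of n] by (metis less_irrefl neqE)
    then show False using d t by auto
  qed
  then have "\<not> inj (\<lambda>n. (g ^^ n) d)"
    using finite_ends[OF f] by (meson finite_subset image_subsetI range_inj_infinite)
  then obtain i j where ij: "i < j" "(g ^^ i) d = (g ^^ j) d"
    unfolding inj_def by (metis neqE)
  then obtain k where "j = i + Suc k" using less_iff_Suc_add by auto
  then have "(g ^^ i) ((g ^^ Suc k) d) = (g ^^ i) d" using ij by (metis comp_apply funpow_add)
  then have "(g ^^ Suc k) d = d" using funpow_plf_mono[OF g, of i] by (metis less_irrefl neqE)
  then show "g d = d" using funpow_fixpoint[OF g] by blast
qed


section \<open>Transferring displacement to a full orbital\<close>

lemma finv_finv: "plf f \<Longrightarrow> finv (finv f) = f"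
  using plf_bij by (simp add: inv_inv_eq)

lemma fn_orbital_exists:
  assumes "plf f" "f p \<noteq> p"
  obtains d e where "d < p" "p < e" "f d = d" "f e = e" "\<And>t. d < t \<Longrightarrow> t < e \<Longrightarrow> f t \<noteq> t"
proof -
  obtain d e where "is_orbital {f} d e" "d < p" "p < e"
    using orbital_exists[of "{f}" p] assms by (auto simp: fixed_def)
  then show thesis using that[of d e] by (auto simp: is_orbital_def fixed_def)
qed

lemma crossing:
  assumes x: "plf x" and uv: "u < v" and sg: "(x u > u \<and> x v < v) \<or> (x u < u \<and> x v > v)"
  obtains e where "u < e" "e < v" "x e = e"
proof -
  have c: "continuous_on {u..v} (\<lambda>t. x t - t)"
    using plf_cont[OF x] by (auto intro!: continuous_intros)
  have "\<exists>e. u \<le> e \<and> e \<le> v \<and> x e - e = 0"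
    using sg IVT'[of "\<lambda>t. x t - t" u 0 v] IVT2'[of "\<lambda>t. x t - t" v 0 u] c uv by auto
  then obtain e where e: "u \<le> e" "e \<le> v" "x e = e" by auto
  then have "u \<noteq> e" "e \<noteq> v" using sg by auto
  then show thesis using that[of e] e by simp
qed

text \<open>Displacement is expressed by commutation, which can be transported: a commutator trivial
  on \<open>V\<close> lies in the kernel \<open>N\<close>, so the relation holds on the closed
  invariant set \<open>K\<close> of points fixed by \<open>N\<close>, and \<open>K\<close> contains
  \<open>q\<close>. There \<open>commuting_fixes_end\<close> turns it into statements about ends.
  The orbital (d', e') of \<open>f'\<close> satisfies \<open>d' < a\<close> and
  \<open>b < e'\<close>, so it suffices that \<open>t\<close> moves it off itself, which happens
  unless \<open>t\<close> fixes \<open>d'\<close>. The second map \<open>f\<close>, with an end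
  \<open>d\<close> inside that orbital, serves to exclude this case.\<close>

lemma transfer:
  assumes L: "plg L" and U: "is_orbital L \<alpha> \<beta>" and rich: "is_orbital (core L) \<alpha> \<beta>"
    and V: "\<And>y t. y \<in> L \<Longrightarrow> t \<in> V \<Longrightarrow> y t \<in> V"
    and q: "\<alpha> < q" "q < \<beta>" and qN: "\<And>f. f \<in> L \<Longrightarrow> (\<And>t. t \<in> V \<Longrightarrow> f t = t) \<Longrightarrow> f q = q"
    and a: "\<alpha> < a" "a < \<beta>" and b: "\<alpha> < b" "b < \<beta>"
  obtains f f' where "f \<in> core L" "f' \<in> core L"
    "\<And>t. t \<in> L \<Longrightarrow>
       (\<And>s h r. s \<in> {t, finv t} \<Longrightarrow> h \<in> {f, f'} \<Longrightarrow> r \<in> V \<Longrightarrow>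
          h (s (f' (finv s r))) = s (f' (finv s (h r)))) \<Longrightarrow> b < t a \<or> t b < a"
proof -
  define N where "N = {f \<in> L. \<forall>t\<in>V. f t = t}"
  define K where "K = fixed N"
  have clK: "closed K" unfolding K_def
    by (rule closed_fixed) (use plg_plf[OF L] in \<open>auto simp: N_def\<close>)
  have qK: "q \<in> K" using qN by (auto simp: K_def fixed_def N_def)
  have Kinv: "y k \<in> K" if y: "y \<in> L" and k: "k \<in> K" for y k
    unfolding K_def fixed_def
  proof (safe)
    fix f assume f: "f \<in> N"
    have "finv y \<circ> f \<circ> y \<in> N"
      using f y V by (auto simp: N_def plg_comp[OF L] plg_inv[OF L] plf_finv1[OF plg_plf[OF L]])
    then have "finv y (f (y k)) = k" using k by (auto simp: K_def fixed_def)
    then show "f (y k) = y k" using plf_finv2[OF plg_plf[OF L y]] by metis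
  qed
  have "q \<notin> fixed (core L)" using rich q by (auto simp: is_orbital_def)
  then obtain f where f: "f \<in> core L" "f q \<noteq> q" by (auto simp: fixed_def)
  note fL = core_sub[OF f(1)]
  note pf = plg_plf[OF L fL]
  obtain d e where d: "d < q" "q < e" "f d = d" and dmv: "\<And>t. d < t \<Longrightarrow> t < e \<Longrightarrow> f t \<noteq> t"
    by (rule fn_orbital_exists[OF pf f(2)]) (rule that)
  obtain lo hi where lo: "\<alpha> < lo" "lo < hi" "hi < \<beta>"
    and losupp: "\<And>r. \<alpha> < r \<Longrightarrow> r < \<beta> \<Longrightarrow> f r \<noteq> r \<Longrightarrow> lo < r \<and> r < hi"
    by (rule core_support[OF f(1) U]) (rule that)
  \<comment> \<open>Otherwise \<open>f\<close> would move points arbitrarily close to \<alpha>,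
    against \<open>core_support\<close>.\<close>
  have "\<alpha> < d"
  proof (rule ccontr)
    assume "\<not> \<alpha> < d"
    then have "f (min lo q) \<noteq> min lo q" using dmv[of "min lo q"] d lo q by auto
    then show False using losupp[of "min lo q"] lo q by (auto simp: min_less_iff_disj)
  qed
  note coreG = plg_core[OF L]
  \<comment> \<open>The point \<open>k\<close> of \<open>K\<close> is placed to the left of
    \<open>d\<close> and \<open>a\<close>, and \<open>f'\<close> is chosen to carry it to the right
    of \<open>d\<close> and \<open>b\<close>, so that the orbital of \<open>f'\<close> around
    \<open>k\<close> is long enough.\<close>
  have "\<alpha> < min d a" "min d a < \<beta>" using \<open>\<alpha> < d\<close> a by auto
  then obtain y where y: "y \<in> core L" "y q < min d a" using far_left[OF coreG rich q(2)] by blast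
  define k where "k = y q"
  have k: "k \<in> K" "\<alpha> < k" "k < d" "k < a" "k < \<beta>"
    using Kinv[OF core_sub[OF y(1)] qK] orbital_mem[OF coreG rich y(1)] y q a by (auto simp: k_def)
  have "max d b < \<beta>" using b d q by auto
  then obtain f' where f': "f' \<in> core L" "max d b < f' k"
    using far_right[OF coreG rich k(2,5)] by blast
  note f'L = core_sub[OF f'(1)]
  note pf' = plg_plf[OF L f'L]
  obtain d' e' where d': "d' < k" "k < e'" "f' d' = d'" "f' e' = e'"
    and mv': "\<And>t. d' < t \<Longrightarrow> t < e' \<Longrightarrow> f' t \<noteq> t"
  proof (rule fn_orbital_exists[OF pf'])
    show "f' k \<noteq> k" using f' k by auto
  qed (rule that)
  have "f' k < e'" using plf_less[OF pf', of k e'] d' by simp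
  then have e': "d < e'" "b < e'" using f' by auto
  have "b < t a \<or> t b < a"
    if t: "t \<in> L" and com: "\<And>s h r. s \<in> {t, finv t} \<Longrightarrow> h \<in> {f, f'} \<Longrightarrow> r \<in> V \<Longrightarrow>
          h (s (f' (finv s r))) = s (f' (finv s (h r)))" for t
  proof -
    define g where "g s = s \<circ> f' \<circ> finv s" for s
    have sL: "s \<in> L" if "s \<in> {t, finv t}" for s using that t plg_inv[OF L t] by auto
    have gL: "g s \<in> L" if "s \<in> {t, finv t}" for s
      unfolding g_def using sL[OF that] f'L L by (simp add: plg_comp plg_inv)
    have comK: "h (g s r) = g s (h r)" if s: "s \<in> {t, finv t}" and h: "h \<in> {f, f'}" and r: "r \<in> K" for s h r
    proof -
      have hL: "h \<in> L" using h fL f'L by auto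
      note ph = plg_plf[OF L hL] and pg = plg_plf[OF L gL[OF s]]
      have "comm h (g s) \<in> N"
        unfolding N_def
      proof (safe)
        show "comm h (g s) \<in> L" using comm_in[OF L hL gL[OF s]] .
        fix v assume "v \<in> V"
        then have r0: "finv h (finv (g s) v) \<in> V" using V plg_inv[OF L] hL gL[OF s] by auto
        have v: "g s (h (finv h (finv (g s) v))) = v"
          by (simp add: plf_finv2[OF ph] plf_finv2[OF pg])
        moreover have "h (g s (finv h (finv (g s) v))) = g s (h (finv h (finv (g s) v)))"
          using com[OF s h r0] by (simp add: g_def)
        ultimately show "comm h (g s) v = v"
          using comm_apply[OF ph pg, of "finv h (finv (g s) v)"] by simp
      qed
      moreover have "g s (h r) \<in> K" using Kinv r hL gL[OF s] by auto
      ultimately have "comm h (g s) (g s (h r)) = g s (h r)" by (auto simp: K_def fixed_def)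
      then show ?thesis using comm_apply[OF ph pg] by simp
    qed
    have gd: "g s d = d" if s: "s \<in> {t, finv t}" for s
      by (rule commuting_fixes_end[OF pf plg_plf[OF L gL[OF s]] clK, of q])
         (use Kinv fL gL[OF s] plg_inv[OF L] comK[OF s] qK d dmv in auto)
    have gd': "g s d' = d'" if s: "s \<in> {t, finv t}" for s
      by (rule commuting_fixes_end[OF pf' plg_plf[OF L gL[OF s]] clK, of k])
         (use Kinv f'L gL[OF s] plg_inv[OF L] comK[OF s] k d' mv' in auto)
    note pt = plg_plf[OF L t]
    have gfix: "g t s = s \<longleftrightarrow> f' (finv t s) = finv t s" for s
      using plf_finv1[OF pt] plf_finv2[OF pt] unfolding g_def comp_def by metis
    \<comment> \<open>The roles are exchanged here: \<open>t d'\<close> is the left end of the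
      orbital of \<open>g t\<close> around \<open>t k\<close>, and \<open>f'\<close> is the
      commuting map.\<close>
    have f'td': "f' (t d') = t d'"
    proof (rule commuting_fixes_end[OF plg_plf[OF L gL] pf' clK, of t "t k"])
      show "g t (f' s) = f' (g t s)" if "s \<in> K" for s using comK[of t f' s] that by simp
      show "g t (t d') = t d'" using gfix d' plf_finv1[OF pt] by simp
      show "g t s \<noteq> s" if "t d' < s" "s \<le> t k" for s
      proof -
        have "d' < finv t s" "finv t s \<le> k"
          using that less_finv[OF pt] finv_less[OF pt] by (auto simp: not_less[symmetric])
        then show ?thesis using mv'[of "finv t s"] d' gfix by auto
      qed
    qed (use Kinv gL f'L t k d' plg_inv[OF L] plf_less[OF pt] in auto)
    consider "t d' < d'" | "t d' > d'" | "t d' = d'" by linarith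
    then show ?thesis
    proof cases
      case 1
      then have "d' < finv t d'" using less_finv[OF pt] by simp
      moreover have "f' (finv t d') = finv t d'" using gfix gd'[of t] by simp
      ultimately have "e' \<le> finv t d'" using mv'[of "finv t d'"] by (meson not_less)
      then have "t e' \<le> d'" using less_finv[OF pt] finv_less[OF pt, of d' e'] by (meson not_less)
      then have "t b < d'" using plf_less[OF pt, of b e'] e' by simp
      then show ?thesis using d' k by simp
    next
      case 2
      then have "e' \<le> t d'" using mv'[of "t d'"] f'td' by (meson not_less)
      moreover have "t d' < t a" using plf_less[OF pt] d' k by simp
      ultimately show ?thesis using e' by simp
    next
      \<comment> \<open>Now \<open>t\<close> fixes \<open>d'\<close>, and one of \<open>t d\<close>
        and \<open>finv t d\<close> lies in (d', e'), where \<open>f'\<close> moves every point. But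
        \<open>d\<close> is fixed by \<open>g (finv t)\<close> and by \<open>g t\<close>, so
        \<open>f'\<close> fixes both points.\<close>
      case 3
      have "t d' < t d" using plf_less[OF pt] d' k by simp
      show ?thesis
      proof (cases "d < t e'")
        case True
        have "d' < finv t d" using less_finv[OF pt] 3 d' k by simp
        moreover have "finv t d < e'" using finv_less[OF pt] True by simp
        ultimately have "f' (finv t d) \<noteq> finv t d" using mv' by simp
        then show ?thesis using gd[of t] gfix by simp
      next
        case False
        have "t d < e'" using plf_less[OF pt, of d e'] e' False by linarith
        then have "f' (t d) \<noteq> t d" using mv'[of "t d"] 3 \<open>t d' < t d\<close> by simp
        moreover have "finv t (f' (t d)) = d" using gd[of "finv t"] finv_finv[OF pt] by (simp add: g_def)
        ultimately show ?thesis using plf_finv2[OF pt] by metis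
      qed
    qed
  qed
  then show thesis using that f(1) f'(1) by blast
qed

lemma disjoint_commute:
  assumes h: "plf h" and g: "plf g" and "\<And>r. r \<in> I \<Longrightarrow> h r \<in> I" "\<And>r. r \<in> I \<Longrightarrow> g r \<in> I"
    and dis: "\<And>r. r \<in> I \<Longrightarrow> h r \<noteq> r \<Longrightarrow> g r = r" and r: "r \<in> I"
  shows "h (g r) = g (h r)"
proof (cases "h r = r")
  case True
  then show ?thesis using dis[of "g r"] assms(4)[OF r] plf_eq[OF g] by metis
next
  case False
  then show ?thesis using dis[of "h r"] dis[of r] assms(3)[OF r] r plf_eq[OF h] by metis
qed

text \<open>Supplies the commutation hypothesis of \<open>transfer\<close> on an orbital where
  \<open>t\<close> displaces an interval containing both supports: the conjugate of \<open>f\<close>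
  then has its support away from that of \<open>h\<close>.\<close>

lemma displaced_commute:
  assumes L: "plg L" and pl: "is_orbital L c d" and h: "h \<in> L" and f: "f \<in> L" and t: "t \<in> L"
    and supph: "\<And>r. c < r \<Longrightarrow> r < d \<Longrightarrow> h r \<noteq> r \<Longrightarrow> lo < r \<and> r < hi"
    and suppf: "\<And>r. c < r \<Longrightarrow> r < d \<Longrightarrow> f r \<noteq> r \<Longrightarrow> lo < r \<and> r < hi"
    and dis: "hi < t lo \<or> t hi < lo" and s: "s \<in> {t, finv t}" and r: "c < r" "r < d"
  shows "h (s (f (finv s r))) = s (f (finv s (h r)))"
proof -
  note pt = plg_plf[OF L t]
  have sL: "s \<in> L" and siL: "finv s \<in> L" using s t plg_inv[OF L] by auto
  note ps = plg_plf[OF L sL]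
  have dis': "hi < s lo \<or> s hi < lo" using s dis less_finv[OF pt] finv_less[OF pt] by auto
  let ?g = "s \<circ> f \<circ> finv s"
  have g: "?g \<in> L" using sL siL f by (simp add: plg_comp[OF L])
  have "h (?g r) = ?g (h r)"
  proof (rule disjoint_commute[OF plg_plf[OF L h] plg_plf[OF L g], of "{c<..<d}"])
    fix r assume r: "r \<in> {c<..<d}" and "h r \<noteq> r"
    then have hr: "lo < r" "r < hi" using supph by auto
    show "?g r = r"
    proof (rule ccontr)
      assume "?g r \<noteq> r"
      then have "f (finv s r) \<noteq> finv s r" using plf_finv2[OF ps] by auto
      then have "lo < finv s r \<and> finv s r < hi"
        using suppf[of "finv s r"] r orbital_mem[OF L pl siL] by auto
      then show False using less_finv[OF ps] finv_less[OF ps] dis' hr by auto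
    qed
  qed (use orbital_mem[OF L pl h] orbital_mem[OF L pl g] r in auto)
  then show ?thesis by simp
qed

text \<open>If the iterates of \<open>lo\<close> never passed \<open>hi\<close>, their supremum
  would not be moved to the right although \<open>lo\<close> is, and the intermediate value theorem
  would give a fixed point.\<close>

lemma power_displaces:
  assumes L: "plg L" and pl: "is_orbital L c d" and x: "x \<in> L"
    and nofix: "\<And>t. c < t \<Longrightarrow> t < d \<Longrightarrow> x t \<noteq> t" and lo: "c < lo" and hi: "hi < d" and lohi: "lo < hi"
  obtains n where "hi < (x ^^ n) lo \<or> (x ^^ n) hi < lo"
proof -
  have up: "\<exists>n. hi < (y ^^ n) lo" if y: "y \<in> L" "lo < y lo" "\<And>t. c < t \<Longrightarrow> t < d \<Longrightarrow> y t \<noteq> t" for y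
  proof (rule ccontr)
    assume "\<nexists>n. hi < (y ^^ n) lo"
    then have le: "(y ^^ n) lo \<le> hi" for n by (meson not_less)
    note py = plg_plf[OF L y(1)]
    define s where "s = (SUP n. (y ^^ n) lo)"
    have bd: "bdd_above (range (\<lambda>n. (y ^^ n) lo))" using le by (auto simp: bdd_above_def)
    have ub: "(y ^^ n) lo \<le> s" for n unfolding s_def using bd by (intro cSUP_upper) auto
    have "s \<le> hi" unfolding s_def using le by (intro cSUP_least) auto
    have "lo < s" using ub[of 1] y by simp
    have "(y ^^ n) lo \<le> finv y s" for n
      using ub[of "Suc n"] finv_less[OF py, of s "(y ^^ n) lo"] by (simp add: not_less[symmetric])
    then have "s \<le> finv y s" unfolding s_def by (intro cSUP_least) auto
    then have "y s \<le> s" using finv_less[OF py, of s s] less_finv[OF py, of s s] by (metis not_less)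
    moreover have "y s \<noteq> s" using y(3)[of s] \<open>lo < s\<close> \<open>s \<le> hi\<close> lo hi by auto
    ultimately obtain e where "lo < e" "e < s" "y e = e"
      using crossing[OF py \<open>lo < s\<close>] y(2) by force
    then show False using y(3)[of e] \<open>s \<le> hi\<close> lo hi by auto
  qed
  show thesis
  proof (cases "lo < x lo")
    case True
    then show thesis using up[OF x True nofix] that by blast
  next
    case False
    note px = plg_plf[OF L x]
    have "lo < finv x lo" using False nofix[of lo] lo hi lohi less_finv[OF px, of lo lo] by auto
    then obtain n where n: "hi < (finv x ^^ n) lo"
      using up[OF plg_inv[OF L x]] nofix finv_fixpoint[OF px] by auto
    have "(x ^^ n) ((finv x ^^ n) lo) = lo"
      using fn_o_inv_fn_is_id[OF plf_bij[OF px], of n] by (simp add: fun_eq_iff)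
    then have "(x ^^ n) hi < lo" using n funpow_plf_mono[OF px, of n hi] by metis
    then show thesis using that by blast
  qed
qed

text \<open>By transfer, if the kernel on \<open>(c, d)\<close> fixed a point of \<open>(\<alpha>, \<beta>)\<close>, then every element without fixed points in \<open>(c, d)\<close> would
  move all points of \<open>(\<alpha>, \<beta>)\<close>; multiplying such an element by a core element gives a contradiction.\<close>
lemma kernel_moves:
  assumes L: "plg L" and U: "is_orbital L \<alpha> \<beta>" and rich: "is_orbital (core L) \<alpha> \<beta>"
    and P: "is_orbital L c d" and z: "c < z" "z < d" "z \<in> fixed (core L)" and q: "\<alpha> < q" "q < \<beta>"
  obtains f where "f \<in> L" "\<And>t. c < t \<Longrightarrow> t < d \<Longrightarrow> f t = t" "f q \<noteq> q"
proof (rule ccontr)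
  assume "\<not> thesis"
  then have ker: "f q = q" if "f \<in> L" "\<And>t. t \<in> {c<..<d} \<Longrightarrow> f t = t" for f
    using that \<open>\<And>f. f \<in> L \<Longrightarrow> (\<And>t. c < t \<Longrightarrow> t < d \<Longrightarrow> f t = t) \<Longrightarrow> f q \<noteq> q \<Longrightarrow> thesis\<close>
    by (meson greaterThanLessThan_iff)
  \<comment> \<open>Some element moves \<open>z\<close> but fixes a point of (\<alpha>, \<beta>). If
    \<open>x\<close> moves \<open>z\<close> and pushes \<open>q\<close> to the right, a strong
    enough core element \<open>f\<close> makes \<open>x \<circ> f\<close> push \<open>q\<close> to
    the left. Near \<alpha> it still agrees with \<open>x\<close>, so it fixes a point in between;
    it still moves \<open>z\<close>, because \<open>f\<close> fixes \<open>z\<close>.\<close>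
  have "\<exists>x e. x \<in> L \<and> x z \<noteq> z \<and> \<alpha> < e \<and> e < \<beta> \<and> x e = e"
  proof (rule ccontr)
    assume "\<not> ?thesis"
    then have nofix: "x e \<noteq> e" if "x \<in> L" "x z \<noteq> z" "\<alpha> < e" "e < \<beta>" for x e using that by blast
    have "z \<notin> fixed L" using P z by (auto simp: is_orbital_def)
    then obtain x1 where x1: "x1 \<in> L" "x1 z \<noteq> z" by (auto simp: fixed_def)
    obtain x where x: "x \<in> L" "x z \<noteq> z" "q < x q"
    proof (cases "q < x1 q")
      case False
      note p1 = plg_plf[OF L x1(1)]
      have "q < finv x1 q" using False nofix[OF x1 q] less_finv[OF p1, of q q] by auto
      then show ?thesis using that[OF plg_inv[OF L x1(1)]] finv_fixpoint[OF p1] x1 by auto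
    qed (use that x1 in blast)
    note px = plg_plf[OF L x(1)]
    have "\<alpha> < finv x q" "finv x q < \<beta>" using orbital_mem[OF L U plg_inv[OF L x(1)]] q by auto
    then obtain f where f: "f \<in> core L" "f q < finv x q" using far_left[OF plg_core[OF L] rich q(2)] by blast
    have xf: "x \<circ> f \<in> L" using plg_comp[OF L x(1) core_sub[OF f(1)]] .
    obtain lo hi where lo: "\<alpha> < lo" "lo < hi" "hi < \<beta>" "\<And>r. \<alpha> < r \<Longrightarrow> r < \<beta> \<Longrightarrow> f r \<noteq> r \<Longrightarrow> lo < r \<and> r < hi"
      by (rule core_support[OF f(1) U]) (rule that)
    define k where "k = (\<alpha> + min lo q) / 2"
    have k: "\<alpha> < k" "k < q" "k < lo" using lo(1) q by (auto simp: k_def min_def field_simps)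
    then have fk: "f k = k" using lo(4)[of k] q by force
    have "k < x k"
      using crossing[OF px k(2)] nofix[OF x(1,2)] x(3) k q by (metis less_trans linorder_neqE)
    moreover have "(x \<circ> f) q < q" using f(2) less_finv[OF px] by simp
    ultimately obtain e where "k < e" "e < q" "(x \<circ> f) e = e"
      using crossing[OF plg_plf[OF L xf] k(2)] fk by auto
    moreover have "(x \<circ> f) z \<noteq> z" using x z f(1) by (auto simp: fixed_def)
    ultimately show False using nofix[OF xf] k q by auto
  qed
  then obtain x e where x: "x \<in> L" "x z \<noteq> z" and e: "\<alpha> < e" "e < \<beta>" "x e = e" by blast
  \<comment> \<open>With both bounds equal to \<open>e\<close>, \<open>transfer\<close> says that
    \<open>t\<close> moves \<open>e\<close>. A power of \<open>x\<close> will meet its hypothesis,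
    yet it fixes \<open>e\<close>.\<close>
  obtain f f' where f: "f \<in> core L" "f' \<in> core L" and T: "\<And>t. t \<in> L \<Longrightarrow>
       (\<And>s h r. s \<in> {t, finv t} \<Longrightarrow> h \<in> {f, f'} \<Longrightarrow> r \<in> {c<..<d} \<Longrightarrow>
          h (s (f' (finv s r))) = s (f' (finv s (h r)))) \<Longrightarrow> e < t e \<or> t e < e"
  proof (rule transfer[OF L U rich, of "{c<..<d}" q e e])
    show "y t \<in> {c<..<d}" if "y \<in> L" "t \<in> {c<..<d}" for y t
      using orbital_mem[OF L P that(1)] that(2) by auto
  qed (use ker q e in auto)
  obtain l1 h1 where 1: "c < l1" "l1 < h1" "h1 < d" "\<And>r. c < r \<Longrightarrow> r < d \<Longrightarrow> f r \<noteq> r \<Longrightarrow> l1 < r \<and> r < h1"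
    by (rule core_support[OF f(1) P]) (rule that)
  obtain l2 h2 where 2: "c < l2" "l2 < h2" "h2 < d" "\<And>r. c < r \<Longrightarrow> r < d \<Longrightarrow> f' r \<noteq> r \<Longrightarrow> l2 < r \<and> r < h2"
    by (rule core_support[OF f(2) P]) (rule that)
  \<comment> \<open>By \<open>fixpoint_spreads\<close> a fixed point of \<open>x\<close> in (c, d)
    would make \<open>x\<close> fix \<open>z\<close>.\<close>
  have nf: "x t \<noteq> t" if "c < t" "t < d" for t
    using fixpoint_spreads[OF L P z x(1) that _ z] x(2) by blast
  have mm: "c < min l1 l2" "max h1 h2 < d" "min l1 l2 < max h1 h2" using 1 2 by auto
  obtain n where n: "max h1 h2 < (x ^^ n) (min l1 l2) \<or> (x ^^ n) (max h1 h2) < min l1 l2"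
    using power_displaces[OF L P x(1) nf mm] by blast
  have xn: "x ^^ n \<in> L" using plg_funpow[OF L x(1)] .
  have "e < (x ^^ n) e \<or> (x ^^ n) e < e"
  proof (rule T[OF xn])
    fix s h r assume "s \<in> {x ^^ n, finv (x ^^ n)}" "h \<in> {f, f'}" "r \<in> {c<..<d}"
    then show "h (s (f' (finv s r))) = s (f' (finv s (h r)))"
      by (intro displaced_commute[OF L P _ core_sub[OF f(2)] xn _ _ n])
         (use 1(4) 2(4) f core_sub in force)+
  qed
  moreover have "(x ^^ n) e = e" using e(3) by (induction n) auto
  ultimately show False by simp
qed


subsection \<open>Killing the orbitals where the core has a fixed point\<close>

definition thin :: "(real \<Rightarrow> real) set \<Rightarrow> (real \<Rightarrow> real) set" where
  "thin L = {v \<in> core L. \<forall>a b. is_orbital L a b \<longrightarrow> \<not> is_orbital (core L) a b \<longrightarrow> (\<forall>t. a < t \<and> t < b \<longrightarrow> v t = t)}"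

lemma plg_kernel:
  assumes "plg L" shows "plg {f \<in> L. \<forall>t\<in>V. f t = t}"
  using assms finv_fixpoint unfolding plg_def by auto

lemma orbital_core_iff:
  assumes "is_orbital L a b"
  shows "is_orbital (core L) a b \<longleftrightarrow> (\<forall>z. a < z \<and> z < b \<longrightarrow> z \<notin> fixed (core L))"
  using assms core_sub unfolding is_orbital_def fixed_def by blast

lemma plg_thin:
  assumes L: "plg L" shows "plg (thin L)"
proof -
  define V where "V = {t. \<exists>a b. is_orbital L a b \<and> \<not> is_orbital (core L) a b \<and> a < t \<and> t < b}"
  have "thin L = {v \<in> core L. \<forall>t\<in>V. v t = t}" by (auto simp: thin_def V_def)
  then show ?thesis using plg_kernel[OF plg_core[OF L]] by simp
qed

lemma orbital_end:
  assumes "f d = d" "d < p" "\<And>t. d < t \<Longrightarrow> t \<le> p \<Longrightarrow> f t \<noteq> t"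
  shows "d \<in> ends f"
proof -
  have "\<not> (\<forall>\<^sub>F s in nhds d. f s = s)"
  proof
    assume "\<forall>\<^sub>F s in nhds d. f s = s"
    then obtain e where e: "e > 0" "\<And>s. dist s d < e \<Longrightarrow> f s = s"
      unfolding eventually_nhds_metric by blast
    define s where "s = min p (d + e / 2)"
    have "d < s" "s \<le> p" "s \<le> d + e / 2" using assms(2) e(1) by (auto simp: s_def)
    then show False using e assms(3)[of s] by (auto simp: dist_real_def)
  qed
  then show ?thesis using assms(1) by (simp add: ends_def)
qed

text \<open>Each orbital of the group in which \<open>f\<close> moves a point contains, in its
  interior or as its left end, the left end of an orbital of \<open>f\<close>. Orbitals closed on
  the left are still disjoint, and \<open>ends f\<close> is finite.\<close>

lemma finite_orbitals:
  assumes L: "plg L" and f: "f \<in> L"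
  shows "finite {(a, b). is_orbital L a b \<and> (\<exists>t. a < t \<and> t < b \<and> f t \<noteq> t)}" (is "finite ?S")
proof -
  note pf = plg_plf[OF L f]
  have ex: "\<exists>d. d \<in> ends f \<and> fst p \<le> d \<and> d < snd p" if pS: "p \<in> ?S" for p
  proof -
    obtain a b t where p: "p = (a, b)" and pl: "is_orbital L a b" and t: "a < t" "t < b" "f t \<noteq> t"
      using pS by auto
    obtain d e where d: "d < t" "t < e" "f d = d" "f e = e" "\<And>s. d < s \<Longrightarrow> s < e \<Longrightarrow> f s \<noteq> s"
      by (rule fn_orbital_exists[OF pf t(3)]) (rule that)
    have "d \<in> ends f" by (rule orbital_end[where f = f and d = d and p = t]) (use d in auto)
    moreover have "f a = a" using pl f by (auto simp: is_orbital_def fixed_def)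
    then have "a \<le> d" using d(5)[of a] d(2) t by (meson less_trans not_less)
    ultimately show ?thesis using p d t by (intro exI[of _ d]) auto
  qed
  define F where "F p = (SOME d. d \<in> ends f \<and> fst p \<le> d \<and> d < snd p)" for p
  have F: "F p \<in> ends f \<and> fst p \<le> F p \<and> F p < snd p" if "p \<in> ?S" for p
    unfolding F_def using someI_ex[OF ex[OF that]] .
  have "inj_on F ?S"
  proof (rule inj_onI)
    fix p p' assume p: "p \<in> ?S" and p': "p' \<in> ?S" and eq: "F p = F p'"
    obtain a b where ab: "p = (a, b)" "is_orbital L a b" using p by auto
    obtain c d where cd: "p' = (c, d)" "is_orbital L c d" using p' by auto
    have m: "a \<le> F p" "F p < b" "c \<le> F p" "F p < d" using F[OF p] F[OF p'] ab cd eq by auto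
    \<comment> \<open>The shared end may be the left end of an orbital, so a point slightly to its
      right is compared.\<close>
    define x where "x = (F p + min b d) / 2"
    have "a < x" "x < b" "c < x" "x < d" using m by (auto simp: x_def min_def field_simps)
    then show "p = p'" using orbital_inside[OF ab(2) _ _ cd(2)] ab cd by auto
  qed
  moreover have "F ` ?S \<subseteq> ends f" using F by blast
  ultimately show ?thesis using finite_ends[OF pf] inj_on_finite by blast
qed

text \<open>One poor orbital is removed at a time by a commutator of \<open>a\<close> with an
  element \<open>b\<close> of its kernel. Such a commutator is trivial on every orbital where
  \<open>a\<close> or \<open>b\<close> is, and it agrees with \<open>a\<close> at \<open>q\<close>
  because \<open>b\<close> pushes \<open>q\<close> off the support of \<open>a\<close>. The clause
  referring back to \<open>g\<close> ensures that no poor orbital outside \<open>S\<close> becomes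
  relevant.\<close>

lemma avoid_bad_orbitals:
  assumes L: "plg L" and U: "is_orbital L \<alpha> \<beta>" and rich: "is_orbital (core L) \<alpha> \<beta>" and q: "\<alpha> < q" "q < \<beta>"
    and g: "g \<in> core L" "g q \<noteq> q" and S: "finite S"
    and poor: "\<And>c d. (c, d) \<in> S \<Longrightarrow> is_orbital L c d \<and> \<not> is_orbital (core L) c d"
  shows "\<exists>a\<in>core L. a q \<noteq> q \<and> (\<forall>(c, d)\<in>S. \<forall>t. c < t \<and> t < d \<longrightarrow> a t = t) \<and>
    (\<forall>c d. is_orbital L c d \<longrightarrow> (\<forall>t. c < t \<and> t < d \<longrightarrow> g t = t) \<longrightarrow> (\<forall>t. c < t \<and> t < d \<longrightarrow> a t = t))"
  using S poor
proof (induction S)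
  case empty
  then show ?case using g by (intro bexI[of _ g]) auto
next
  case (insert p S)
  obtain c d where p: "p = (c, d)" by (cases p)
  have P: "is_orbital L c d" "\<not> is_orbital (core L) c d" using insert.prems p by auto
  have IHp: "is_orbital L c d \<and> \<not> is_orbital (core L) c d" if "(c, d) \<in> S" for c d
    using insert.prems that by auto
  obtain a where a: "a \<in> core L" "a q \<noteq> q" "\<forall>(c, d)\<in>S. \<forall>t. c < t \<and> t < d \<longrightarrow> a t = t"
    "\<forall>c d. is_orbital L c d \<longrightarrow> (\<forall>t. c < t \<and> t < d \<longrightarrow> g t = t) \<longrightarrow> (\<forall>t. c < t \<and> t < d \<longrightarrow> a t = t)"
    using insert.IH[OF IHp] by blast
  obtain z where z: "c < z" "z < d" "z \<in> fixed (core L)" using P orbital_core_iff by blast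
  define N where "N = {f \<in> L. \<forall>t\<in>{c<..<d}. f t = t}"
  have N: "plg N" unfolding N_def by (rule plg_kernel[OF L])
  have "s \<notin> fixed N" if s: "\<alpha> < s" "s < \<beta>" for s
  proof -
    obtain f where "f \<in> L" "\<And>t. c < t \<Longrightarrow> t < d \<Longrightarrow> f t = t" "f s \<noteq> s"
      by (rule kernel_moves[OF L U rich P(1) z s]) (rule that)
    then show ?thesis by (auto simp: N_def fixed_def)
  qed
  then have NU: "is_orbital N \<alpha> \<beta>" using U by (auto simp: is_orbital_def fixed_def N_def)
  obtain lo hi where lo: "\<alpha> < lo" "lo < hi" "hi < \<beta>" "\<And>r. \<alpha> < r \<Longrightarrow> r < \<beta> \<Longrightarrow> a r \<noteq> r \<Longrightarrow> lo < r \<and> r < hi"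
    by (rule core_support[OF a(1) U]) (rule that)
  have "lo < \<beta>" using lo by simp
  then obtain b where b: "b \<in> N" "b q < lo" using far_left[OF N NU q(2) lo(1)] by blast
  have bL: "b \<in> L" and bV: "\<And>t. c < t \<Longrightarrow> t < d \<Longrightarrow> b t = t" using b by (auto simp: N_def)
  note aL = core_sub[OF a(1)]
  note pa = plg_plf[OF L aL] and pb = plg_plf[OF L bL]
  have "a (b q) = b q" using lo(4)[of "b q"] b(2) orbital_mem[OF L U bL] q by force
  define h where "h = comm a (finv b)"
  have hC: "h \<in> core L" unfolding h_def using comm_core[OF L aL plg_inv[OF L bL]] .
  have hx: "h t = a (finv b (finv a (b t)))" for t
    by (simp add: h_def comm_def finv_finv[OF pb])
  have "finv a (b q) = b q" using \<open>a (b q) = b q\<close> finv_fixpoint[OF pa] by simp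
  then have hq: "h q = a q" by (simp add: hx plf_finv1[OF pb])
  have htriv: "h t = t" if c': "is_orbital L c' d'" "\<And>t. c' < t \<Longrightarrow> t < d' \<Longrightarrow> a t = t" and t: "c' < t" "t < d'" for c' d' t
  proof -
    have "a (b t) = b t" using c'(2) orbital_mem[OF L c'(1) bL] t by simp
    then have "finv a (b t) = b t" using finv_fixpoint[OF pa] by simp
    then show ?thesis using c'(2)[OF t] by (simp add: hx plf_finv1[OF pb])
  qed
  have hcd: "h t = t" if t: "c < t" "t < d" for t
  proof -
    have "c < finv a t" "finv a t < d" using orbital_mem[OF L P(1) plg_inv[OF L aL]] t by auto
    then have "b (finv a t) = finv a t" using bV by simp
    then have "finv b (finv a t) = finv a t" using finv_fixpoint[OF pb] by simp
    then show ?thesis using bV[OF t] by (simp add: hx plf_finv2[OF pa])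
  qed
  show ?case
  proof (intro bexI[of _ h] conjI)
    show "h q \<noteq> q" using hq a by simp
    show "\<forall>(c, d)\<in>insert p S. \<forall>t. c < t \<and> t < d \<longrightarrow> h t = t"
      using hcd htriv a(3) IHp p by fast
    show "\<forall>c d. is_orbital L c d \<longrightarrow> (\<forall>t. c < t \<and> t < d \<longrightarrow> g t = t) \<longrightarrow> (\<forall>t. c < t \<and> t < d \<longrightarrow> h t = t)"
      using htriv a(4) by blast
  qed (rule hC)
qed

lemma thin_moves:
  assumes L: "plg L" and U: "is_orbital L \<alpha> \<beta>" and rich: "is_orbital (core L) \<alpha> \<beta>" and q: "\<alpha> < q" "q < \<beta>"
  obtains v where "v \<in> thin L" "v q \<noteq> q"
proof -
  have "q \<notin> fixed (core L)" using rich q by (auto simp: is_orbital_def)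
  then obtain g where g: "g \<in> core L" "g q \<noteq> q" by (auto simp: fixed_def)
  \<comment> \<open>Only the poor orbitals that \<open>g\<close> actually meets need treatment, and
    these are finitely many.\<close>
  define S where "S = {(a, b). is_orbital L a b \<and> (\<exists>t. a < t \<and> t < b \<and> g t \<noteq> t)} - {(a, b). is_orbital (core L) a b}"
  have fin: "finite S" unfolding S_def using finite_orbitals[OF L core_sub[OF g(1)]] by simp
  obtain a where a: "a \<in> core L" "a q \<noteq> q" "\<forall>(c, d)\<in>S. \<forall>t. c < t \<and> t < d \<longrightarrow> a t = t"
    "\<forall>c d. is_orbital L c d \<longrightarrow> (\<forall>t. c < t \<and> t < d \<longrightarrow> g t = t) \<longrightarrow> (\<forall>t. c < t \<and> t < d \<longrightarrow> a t = t)"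
    using avoid_bad_orbitals[OF L U rich q g fin] unfolding S_def by blast
  have "a t = t" if "is_orbital L c d" "\<not> is_orbital (core L) c d" "c < t" "t < d" for c d t
  proof (cases "(c, d) \<in> S")
    case False
    then have "\<forall>t. c < t \<and> t < d \<longrightarrow> g t = t" using that by (auto simp: S_def)
    then show ?thesis using a(4) that by blast
  qed (use a(3) that in blast)
  then have "a \<in> thin L" using a(1) by (auto simp: thin_def)
  then show thesis using that a(2) by blast
qed

text \<open>A common fixed point of \<open>thin L\<close> is fixed by \<open>L\<close> or lies in a
  poor orbital, where \<open>thin L\<close> acts trivially; \<open>thin_moves\<close> excludes the
  full orbitals. So within \<open>thin L\<close> every element has compact support in every orbital,
  and displacement can be iterated without leaving the group.\<close>

lemma core_thin:
  assumes L: "plg L" shows "core (thin L) = thin L"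
proof
  show "thin L \<subseteq> core (thin L)"
  proof
    fix v assume v: "v \<in> thin L"
    show "v \<in> core (thin L)" unfolding core_def
    proof (safe)
      fix t assume t: "t \<in> fixed (thin L)"
      show "\<forall>\<^sub>F x in nhds t. v x = x"
      proof (cases "t \<in> fixed L")
        case True
        then show ?thesis using v by (simp add: thin_def core_def)
      next
        case False
        then obtain a b where ab: "is_orbital L a b" "a < t" "t < b"
          using orbital_exists[of L t] plg_plf[OF L] by blast
        have "\<not> is_orbital (core L) a b"
        proof
          assume "is_orbital (core L) a b"
          then obtain w where "w \<in> thin L" "w t \<noteq> t" using thin_moves[OF L ab(1) _ ab(2,3)] by blast
          then show False using t by (simp add: fixed_def)
        qed
        then have triv: "\<forall>x. a < x \<and> x < b \<longrightarrow> v x = x" using v ab by (auto simp: thin_def)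
        have tab: "t \<in> {a<..<b}" using ab by simp
        show ?thesis
          by (rule eventually_mono[OF eventually_nhds_in_open[OF _ tab]]) (use triv in auto)
      qed
    qed (rule v)
  qed
qed (auto simp: core_def)

subsection \<open>Simultaneous displacement\<close>

text \<open>If the kernel \<open>N\<close> of the action on the old orbitals has no fixed point in
  the new one, an element of \<open>N\<close> corrects a given displacement there and leaves the
  others untouched. Otherwise \<open>transfer\<close> applies: displacing larger intervals on the
  old orbitals forces displacement on the new one.\<close>

lemma simultaneous_displacement:
  assumes G: "plg G" and cG: "core G = G" and S: "finite S"
    and "\<And>a b. (a, b) \<in> S \<Longrightarrow> is_orbital G a b \<and> a < lo (a, b) \<and> lo (a, b) < b \<and> a < hi (a, b) \<and> hi (a, b) < b"
  shows "\<exists>t\<in>G. \<forall>p\<in>S. hi p < t (lo p) \<or> t (hi p) < lo p"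
  using S assms(4)
\<comment> \<open>The bounds are generalised because the second case uses the induction hypothesis
  for intervals enlarged to contain the supports of \<open>f\<close> and \<open>f'\<close>.\<close>
proof (induction S arbitrary: lo hi)
  case empty
  then show ?case using plg_id[OF G] by auto
next
  case (insert p S)
  obtain \<alpha> \<beta> where p: "p = (\<alpha>, \<beta>)" by (cases p)
  have U: "is_orbital G \<alpha> \<beta>" and lo: "\<alpha> < lo p" "lo p < \<beta>" and hi: "\<alpha> < hi p" "hi p < \<beta>"
    using insert.prems p by auto
  have rich: "is_orbital (core G) \<alpha> \<beta>" using U cG by simp
  have pS: "is_orbital G a b \<and> a < lo (a, b) \<and> lo (a, b) < b \<and> a < hi (a, b) \<and> hi (a, b) < b" if "(a, b) \<in> S" for a b
    using insert.prems that by blast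
  define V where "V = {t. \<exists>(a, b)\<in>S. a < t \<and> t < b}"
  define N where "N = {f \<in> G. \<forall>t\<in>V. f t = t}"
  have N: "plg N" unfolding N_def by (rule plg_kernel[OF G])
  show ?case
  proof (cases "\<exists>q. \<alpha> < q \<and> q < \<beta> \<and> q \<in> fixed N")
    case False
    then have NU: "is_orbital N \<alpha> \<beta>" using U by (auto simp: is_orbital_def fixed_def N_def)
    obtain t where t: "t \<in> G" "\<forall>p\<in>S. hi p < t (lo p) \<or> t (hi p) < lo p"
      using insert.IH[OF pS] by blast
    have "\<alpha> < t (lo p)" "t (lo p) < \<beta>" using orbital_mem[OF G U t(1)] lo by auto
    then obtain n where n: "n \<in> N" "hi p < n (t (lo p))" using far_right[OF N NU _ _ hi(2)] by blast
    have nG: "n \<in> G" and nV: "\<And>s. s \<in> V \<Longrightarrow> n s = s" using n by (auto simp: N_def)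
    have "hi r < n (t (lo r)) \<or> n (t (hi r)) < lo r" if r: "r \<in> S" for r
    proof -
      obtain a b where ab: "r = (a, b)" by (cases r)
      have "t (lo r) \<in> V" "t (hi r) \<in> V"
        using pS[of a b] r ab orbital_mem[OF G _ t(1), of a b] by (auto simp: V_def)
      then show ?thesis using nV t(2) r by simp
    qed
    then show ?thesis using n plg_comp[OF G nG t(1)] by (intro bexI[of _ "n \<circ> t"]) auto
  next
    case True
    then obtain q where q: "\<alpha> < q" "q < \<beta>" "q \<in> fixed N" by blast
    obtain f f' where f: "f \<in> core G" "f' \<in> core G" and T: "\<And>t. t \<in> G \<Longrightarrow>
       (\<And>s h r. s \<in> {t, finv t} \<Longrightarrow> h \<in> {f, f'} \<Longrightarrow> r \<in> V \<Longrightarrow>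
          h (s (f' (finv s r))) = s (f' (finv s (h r)))) \<Longrightarrow> hi p < t (lo p) \<or> t (hi p) < lo p"
    proof (rule transfer[OF G U rich, of V q "lo p" "hi p"])
      show "y t \<in> V" if "y \<in> G" "t \<in> V" for y t
        using that orbital_mem[OF G _ that(1)] pS unfolding V_def by fast
      show "h q = q" if "h \<in> G" "\<And>t. t \<in> V \<Longrightarrow> h t = t" for h
        using that q(3) by (auto simp: N_def fixed_def)
    qed (use q lo hi in auto)
    have "\<exists>l h. fst r < l \<and> h < snd r \<and> l < h \<and> l \<le> lo r \<and> hi r \<le> h \<and>
        (\<forall>k\<in>{f, f'}. \<forall>s. fst r < s \<and> s < snd r \<and> k s \<noteq> s \<longrightarrow> l < s \<and> s < h)" if r: "r \<in> S" for r
    proof -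
      obtain a b where ab: "r = (a, b)" by (cases r)
      note P = pS[of a b, folded ab, OF r]
      have pl: "is_orbital G a b" using P by blast
      obtain l1 h1 where 1: "a < l1" "l1 < h1" "h1 < b" "\<And>r. a < r \<Longrightarrow> r < b \<Longrightarrow> f r \<noteq> r \<Longrightarrow> l1 < r \<and> r < h1"
        by (rule core_support[OF f(1) pl]) (rule that)
      obtain l2 h2 where 2: "a < l2" "l2 < h2" "h2 < b" "\<And>r. a < r \<Longrightarrow> r < b \<Longrightarrow> f' r \<noteq> r \<Longrightarrow> l2 < r \<and> r < h2"
        by (rule core_support[OF f(2) pl]) (rule that)
      define l where "l = min (min l1 l2) (lo r)"
      define h where "h = max (max h1 h2) (hi r)"
      have "a < l" "h < b" "l \<le> lo r" "hi r \<le> h" using 1 2 P by (auto simp: l_def h_def)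
      moreover have "l < h" using 1(2) by (auto simp: l_def h_def min_def max_def)
      moreover have "l < s \<and> s < h" if "k \<in> {f, f'}" "a < s" "s < b" "k s \<noteq> s" for k s
        using that 1(4)[of s] 2(4)[of s] by (auto simp: l_def h_def min_less_iff_disj less_max_iff_disj)
      ultimately show ?thesis using ab by (intro exI[of _ l] exI[of _ h]) auto
    qed
    then obtain l h where lh: "\<And>r. r \<in> S \<Longrightarrow> fst r < l r \<and> h r < snd r \<and> l r < h r \<and> l r \<le> lo r \<and> hi r \<le> h r \<and>
        (\<forall>k\<in>{f, f'}. \<forall>s. fst r < s \<and> s < snd r \<and> k s \<noteq> s \<longrightarrow> l r < s \<and> s < h r)"
      by metis
    have "\<exists>t\<in>G. \<forall>p\<in>S. h p < t (l p) \<or> t (h p) < l p"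
    proof (rule insert.IH)
      show "is_orbital G a b \<and> a < l (a, b) \<and> l (a, b) < b \<and> a < h (a, b) \<and> h (a, b) < b" if "(a, b) \<in> S" for a b
        using lh[OF that] pS[OF that] by auto
    qed
    then obtain t where t: "t \<in> G" "\<forall>p\<in>S. h p < t (l p) \<or> t (h p) < l p" by blast
    have "hi p < t (lo p) \<or> t (hi p) < lo p"
    proof (rule T[OF t(1)])
      fix s k r assume s: "s \<in> {t, finv t}" and k: "k \<in> {f, f'}" and r: "r \<in> V"
      obtain a b where ab: "(a, b) \<in> S" "a < r" "r < b" using r by (auto simp: V_def)
      have pl: "is_orbital G a b" using pS[OF ab(1)] by blast
      have kG: "k \<in> G" using k f core_sub by auto
      have supp: "l (a, b) < u \<and> u < h (a, b)" if "k' \<in> {f, f'}" "a < u" "u < b" "k' u \<noteq> u" for k' u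
        using lh[OF ab(1)] that by auto
      show "k (s (f' (finv s r))) = s (f' (finv s (k r)))"
        by (rule displaced_commute[OF G pl kG core_sub[OF f(2)] t(1) supp[OF k] supp _ s ab(2,3)])
           (use t(2) ab in auto)
    qed
    moreover have "hi r < t (lo r) \<or> t (hi r) < lo r" if r: "r \<in> S" for r
    proof -
      have "l r \<le> lo r" "hi r \<le> h r" using lh[OF r] by auto
      then have "t (l r) \<le> t (lo r)" "t (hi r) \<le> t (h r)" using plf_le[OF plg_plf[OF G t(1)]] by auto
      then show ?thesis using t(2) r \<open>l r \<le> lo r\<close> \<open>hi r \<le> h r\<close> by (meson le_less_trans less_le_trans)
    qed
    ultimately have "\<forall>r\<in>insert p S. hi r < t (lo r) \<or> t (hi r) < lo r" by blast
    then show ?thesis using t(1) by blast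
  qed
qed

text \<open>It suffices that \<open>w\<close> displaces an interval around the support of
  \<open>v\<close> in each of the finitely many orbitals that \<open>v\<close> meets:
  \<open>w\<close> is increasing, so further iterates stay beyond the interval on the same
  side.\<close>

lemma next_generator:
  assumes G: "plg G" and cG: "core G = G" and v: "v \<in> G"
  obtains w where "w \<in> G" "\<And>n t. v t \<noteq> t \<Longrightarrow> v ((w ^^ Suc n) t) = (w ^^ Suc n) t"
proof -
  define S where "S = {(a, b). is_orbital G a b \<and> (\<exists>t. a < t \<and> t < b \<and> v t \<noteq> t)}"
  have fin: "finite S" unfolding S_def by (rule finite_orbitals[OF G v])
  have "\<exists>l h. fst r < l \<and> l < h \<and> h < snd r \<and> (\<forall>s. fst r < s \<and> s < snd r \<and> v s \<noteq> s \<longrightarrow> l < s \<and> s < h)"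
    if r: "r \<in> S" for r
  proof -
    obtain a b where ab: "r = (a, b)" by (cases r)
    then have "is_orbital G a b" using r by (auto simp: S_def)
    moreover have "v \<in> core G" using v cG by simp
    ultimately obtain l h where "a < l" "l < h" "h < b" "\<And>r. a < r \<Longrightarrow> r < b \<Longrightarrow> v r \<noteq> r \<Longrightarrow> l < r \<and> r < h"
      using core_support[of v G a b thesis] by (metis core_support)
    then show ?thesis using ab by auto
  qed
  then obtain lo hi where lh: "\<And>r. r \<in> S \<Longrightarrow> fst r < lo r \<and> lo r < hi r \<and> hi r < snd r \<and>
      (\<forall>s. fst r < s \<and> s < snd r \<and> v s \<noteq> s \<longrightarrow> lo r < s \<and> s < hi r)"
    by metis
  have "\<exists>w\<in>G. \<forall>p\<in>S. hi p < w (lo p) \<or> w (hi p) < lo p"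
  proof (rule simultaneous_displacement[OF G cG fin])
    show "is_orbital G a b \<and> a < lo (a, b) \<and> lo (a, b) < b \<and> a < hi (a, b) \<and> hi (a, b) < b" if "(a, b) \<in> S" for a b
      using lh[OF that] that by (auto simp: S_def)
  qed
  then obtain w where w: "w \<in> G" "\<forall>p\<in>S. hi p < w (lo p) \<or> w (hi p) < lo p" by blast
  have "v ((w ^^ Suc n) t) = (w ^^ Suc n) t" if t: "v t \<noteq> t" for n t
  proof (rule ccontr)
    assume ne: "v ((w ^^ Suc n) t) \<noteq> (w ^^ Suc n) t"
    have "t \<notin> fixed G" using t v by (auto simp: fixed_def)
    then obtain a b where ab: "is_orbital G a b" "a < t" "t < b"
      using orbital_exists[of G t] plg_plf[OF G] by blast
    then have r: "(a, b) \<in> S" using t by (auto simp: S_def)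
    define l h where "l = lo (a, b)" and "h = hi (a, b)"
    have lht: "l < t" "t < h" using lh[OF r] ab t by (auto simp: l_def h_def)
    note wn = plg_funpow[OF G w(1), of "Suc n"]
    have "a < (w ^^ Suc n) t" "(w ^^ Suc n) t < b" using orbital_mem[OF G ab(1) wn] ab by auto
    then have in': "l < (w ^^ Suc n) t" "(w ^^ Suc n) t < h" using lh[OF r] ne by (auto simp: l_def h_def)
    note pw = plg_plf[OF G w(1)]
    have "h < w l \<or> w h < l" using w(2) r by (auto simp: l_def h_def)
    then show False
    proof
      assume up: "h < w l"
      have "h < (w ^^ Suc m) l" for m
      proof (induction m)
        case (Suc m)
        then have "w l < w ((w ^^ Suc m) l)" using plf_less[OF pw] lht by (meson less_trans)
        then show ?case using up by simp
      qed (use up in simp)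
      then show False using funpow_plf_mono[OF pw, of "Suc n" l t] lht in' by (meson less_trans less_asym)
    next
      assume dn: "w h < l"
      have "(w ^^ Suc m) h < l" for m
      proof (induction m)
        case (Suc m)
        then have "w ((w ^^ Suc m) h) < w h" using plf_less[OF pw] lht by (meson less_trans)
        then show ?case using dn by simp
      qed (use dn in simp)
      then show False using funpow_plf_mono[OF pw, of "Suc n" t h] lht in' by (meson less_trans less_asym)
    qed
  qed
  then show thesis using that w(1) by blast
qed


subsection \<open>Wreath products from displacement\<close>

definition ipow :: "(real \<Rightarrow> real) \<Rightarrow> int \<Rightarrow> real \<Rightarrow> real" where
  "ipow u j = (if 0 \<le> j then u ^^ nat j else finv u ^^ nat (- j))"

lemma ipow_0 [simp]: "ipow u 0 = id"
  by (simp add: ipow_def)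

lemma ipow_Suc:
  assumes "plf u" shows "ipow u (j + 1) t = u (ipow u j t)"
proof (cases "0 \<le> j")
  case True
  then have "nat (j + 1) = Suc (nat j)" by simp
  then show ?thesis using True by (simp add: ipow_def)
next
  case False
  then have "nat (- j) = Suc (nat (- (j + 1)))" by simp
  then have "u (ipow u j t) = (finv u ^^ nat (- (j + 1))) t"
    using False plf_finv2[OF assms] by (simp add: ipow_def)
  moreover have "ipow u (j + 1) = finv u ^^ nat (- (j + 1))"
    using False by (cases "j = -1") (auto simp: ipow_def)
  ultimately show ?thesis by simp
qed

lemma ipow_add:
  assumes "plf u" shows "ipow u i (ipow u j t) = ipow u (i + j) t"
proof (induction i rule: int_induct[where k = 0])
  case (step1 i)
  have "ipow u (i + 1 + j) t = u (ipow u (i + j) t)"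
    using ipow_Suc[OF assms, of "i + j" t] by (simp add: ac_simps)
  then show ?case using step1 ipow_Suc[OF assms, of i] by simp
next
  case (step2 i)
  have "u (ipow u (i - 1 + j) t) = ipow u (i + j) t"
    using ipow_Suc[OF assms, of "i - 1 + j" t] by (simp add: ac_simps)
  moreover have "u (ipow u (i - 1) (ipow u j t)) = ipow u i (ipow u j t)"
    using ipow_Suc[OF assms, of "i - 1"] by simp
  ultimately show ?case using step2 plf_eq[OF assms] by metis
qed simp

lemma ipow_in: "plg L \<Longrightarrow> u \<in> L \<Longrightarrow> ipow u j \<in> L"
  by (simp add: ipow_def plg_funpow plg_inv)

lemma ipow_fixpoint: "plf u \<Longrightarrow> u t = t \<Longrightarrow> ipow u j t = t"
proof -
  assume u: "plf u" "u t = t"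
  have "(f ^^ n) t = t" if "f t = t" for f :: "real \<Rightarrow> real" and n
    using that by (induction n) auto
  then show ?thesis using u finv_fixpoint by (simp add: ipow_def)
qed

text \<open>The commuting product of the conjugates \<open>u\<^sup>-\<^sup>j \<circ> \<phi> j \<circ> u\<^sup>j\<close>; meaningful if the sets \<open>u\<^sup>-\<^sup>j S\<close> are disjoint.\<close>
definition base :: "(real \<Rightarrow> real) \<Rightarrow> real set \<Rightarrow> (int \<Rightarrow> real \<Rightarrow> real) \<Rightarrow> real \<Rightarrow> real" where
  "base u S \<phi> t = (if \<exists>j. ipow u j t \<in> S
     then (let j = (SOME j. ipow u j t \<in> S) in ipow u (- j) (\<phi> j (ipow u j t))) else t)"

locale displacing =
  fixes L u S
  assumes L: "plg L" and u: "u \<in> L"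
    and disj: "\<And>t j. t \<in> S \<Longrightarrow> ipow u j t \<in> S \<Longrightarrow> j = 0"
begin

lemma pu: "plf u"
  using plg_plf[OF L u] .

lemma base_on:
  assumes "t \<in> S" shows "base u S \<phi> (ipow u (- j) t) = ipow u (- j) (\<phi> j t)"
proof -
  \<comment> \<open>Disjointness of the translates makes the index chosen in \<open>base\<close>
    unique.\<close>
  have e: "ipow u i (ipow u (- j) t) \<in> S \<longleftrightarrow> i = j" for i
    using disj[OF assms, of "i - j"] assms by (auto simp: ipow_add[OF pu])
  then have "(SOME i. ipow u i (ipow u (- j) t) \<in> S) = j" by simp
  moreover have "\<exists>i. ipow u i (ipow u (- j) t) \<in> S" using e by blast
  ultimately show ?thesis unfolding base_def Let_def by (simp add: ipow_add[OF pu])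
qed

lemma base_off: "(\<And>j. ipow u j t \<notin> S) \<Longrightarrow> base u S \<phi> t = t"
  by (simp add: base_def)

lemma base_cases:
  obtains (on) j s where "s \<in> S" "t = ipow u (- j) s" | (off) "\<And>j. ipow u j t \<notin> S"
proof (cases "\<exists>j. ipow u j t \<in> S")
  case True
  then obtain j where "ipow u j t \<in> S" by blast
  moreover have "t = ipow u (- j) (ipow u j t)" by (simp add: ipow_add[OF pu])
  ultimately show thesis using on by blast
qed (use off in blast)

lemma base_comp:
  assumes "\<And>j t. t \<in> S \<Longrightarrow> \<phi> j t \<in> S"
  shows "base u S (\<lambda>j. \<psi> j \<circ> \<phi> j) = base u S \<psi> \<circ> base u S \<phi>"
proof
  fix t show "base u S (\<lambda>j. \<psi> j \<circ> \<phi> j) t = (base u S \<psi> \<circ> base u S \<phi>) t"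
    by (cases t rule: base_cases) (simp_all add: base_on base_off assms)
qed

text \<open>Conjugation by a power of \<open>u\<close> permutes the translates of \<open>S\<close>;
  this realises the shift action in the wreath product.\<close>

lemma base_shift:
  "base u S (\<lambda>j. \<phi> (j - n)) = ipow u (- n) \<circ> base u S \<phi> \<circ> ipow u n"
proof
  fix t show "base u S (\<lambda>j. \<phi> (j - n)) t = (ipow u (- n) \<circ> base u S \<phi> \<circ> ipow u n) t"
  proof (cases t rule: base_cases)
    case (on j s)
    have "ipow u n t = ipow u (- (j - n)) s" using on by (simp add: ipow_add[OF pu])
    then have "base u S \<phi> (ipow u n t) = ipow u (- (j - n)) (\<phi> (j - n) s)"
      using base_on[OF on(1), of \<phi> "j - n"] by simp
    then show ?thesis using on by (simp add: base_on ipow_add[OF pu])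
  next
    case off
    then have "base u S \<phi> (ipow u n t) = ipow u n t" by (intro base_off) (simp add: ipow_add[OF pu])
    then show ?thesis using off by (simp add: base_off ipow_add[OF pu])
  qed
qed

lemma base_single:
  assumes "\<And>t. t \<notin> S \<Longrightarrow> f t = t"
  shows "base u S (\<lambda>i. if i = j then f else id) = ipow u (- j) \<circ> f \<circ> ipow u j"
proof
  fix t show "base u S (\<lambda>i. if i = j then f else id) t = (ipow u (- j) \<circ> f \<circ> ipow u j) t"
  proof (cases t rule: base_cases)
    case (on i s)
    show ?thesis
    proof (cases "i = j")
      case False
      then have "ipow u (j - i) s \<notin> S" using disj[OF on(1), of "j - i"] by auto
      then show ?thesis using on False assms by (simp add: base_on ipow_add[OF pu])
    qed (use on in \<open>simp add: base_on ipow_add[OF pu]\<close>)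
  next
    case off
    then show ?thesis using assms by (simp add: base_off ipow_add[OF pu])
  qed
qed

lemma base_id: "base u S (\<lambda>j. id) = id"
proof
  fix t show "base u S (\<lambda>j. id) t = id t"
    by (cases t rule: base_cases) (simp_all add: base_on base_off)
qed

text \<open>The function \<open>base\<close> is defined pointwise, so membership in \<open>L\<close>
  must be earned: a finite family is peeled off factor by factor, each factor being a conjugate by
  \<open>base_single\<close>.\<close>

lemma base_in:
  assumes "finite J" "{j. \<phi> j \<noteq> id} \<subseteq> J" "\<And>j. \<phi> j \<in> L" "\<And>j t. t \<notin> S \<Longrightarrow> \<phi> j t = t"
    "\<And>j t. t \<in> S \<Longrightarrow> \<phi> j t \<in> S"
  shows "base u S \<phi> \<in> L"
  using assms
proof (induction J arbitrary: \<phi>)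
  case empty
  then have "\<phi> = (\<lambda>j. id)" by (simp add: fun_eq_iff)
  then show ?case using plg_id[OF L] by (simp only: base_id)
next
  case (insert j J)
  have "base u S (\<phi>(j := id)) \<in> L"
    by (rule insert.IH) (use insert.prems plg_id[OF L] in auto)
  moreover have "base u S (\<lambda>i. if i = j then \<phi> j else id) \<in> L"
  proof -
    have "base u S (\<lambda>i. if i = j then \<phi> j else id) = ipow u (- j) \<circ> \<phi> j \<circ> ipow u j"
      by (rule base_single) (rule insert.prems(3))
    then show ?thesis using insert.prems(2)[of j] ipow_in[OF L u] plg_comp[OF L] by simp
  qed
  moreover have "base u S \<phi> = base u S (\<phi>(j := id)) \<circ> base u S (\<lambda>i. if i = j then \<phi> j else id)"
  proof -
    have "\<phi> = (\<lambda>i. (\<phi>(j := id)) i \<circ> (if i = j then \<phi> j else id))" by (auto simp: fun_eq_iff)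
    then have "base u S \<phi> = base u S (\<lambda>i. (\<phi>(j := id)) i \<circ> (if i = j then \<phi> j else id))" by simp
    also have "\<dots> = base u S (\<phi>(j := id)) \<circ> base u S (\<lambda>i. if i = j then \<phi> j else id)"
      by (rule base_comp) (use insert.prems in auto)
    finally show ?thesis .
  qed
  ultimately show ?case using plg_comp[OF L] by (simp only:)
qed

end

text \<open>The base part acts first and the shift second, as the right action demands; by
  \<open>base_shift\<close> this matches the index \<open>i - n\<close> in the product of
  \<open>wrZ\<close>. The value \<open>id\<close> at the wrong constructor is a default outside the
  carriers.\<close>

primrec emb :: "(nat \<Rightarrow> real \<Rightarrow> real) \<Rightarrow> nat \<Rightarrow> wr \<Rightarrow> real \<Rightarrow> real" where
  "emb v 0 w = (case w of WBase a \<Rightarrow> ipow (v 0) a | WPair f n \<Rightarrow> id)"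
| "emb v (Suc k) w = (case w of WBase a \<Rightarrow> id | WPair f n \<Rightarrow>
     ipow (v (Suc k)) n \<circ> base (v (Suc k)) {t. v k t \<noteq> t} (\<lambda>j. emb v k (f j)))"

locale nested_displacement =
  fixes L and v :: "nat \<Rightarrow> real \<Rightarrow> real"
  assumes L: "plg L" and vL: "\<And>k. v k \<in> L" and v0: "v 0 \<noteq> id"
    and dis: "\<And>k n t. v k t \<noteq> t \<Longrightarrow> v k ((v (Suc k) ^^ Suc n) t) = (v (Suc k) ^^ Suc n) t"
begin

lemma pv: "plf (v k)"
  using plg_plf[OF L vL] .

lemma displacing: "displacing L (v (Suc k)) {t. v k t \<noteq> t}"
proof
  fix t j assume t: "t \<in> {t. v k t \<noteq> t}" and j: "ipow (v (Suc k)) j t \<in> {t. v k t \<noteq> t}"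
  show "j = 0"
  proof (rule ccontr)
    assume "j \<noteq> 0"
    then consider "j > 0" | "- j > 0" by linarith
    then show False
    proof cases
      case 1
      then have "ipow (v (Suc k)) j = v (Suc k) ^^ Suc (nat (j - 1))"
        by (simp add: ipow_def Suc_nat_eq_nat_zadd1 del: funpow.simps)
      then show False using dis[of k t "nat (j - 1)"] t j by simp
    next
      \<comment> \<open>A negative power is undone by a positive one, so the two points exchange
        roles.\<close>
      case 2
      define s where "s = ipow (v (Suc k)) j t"
      have "ipow (v (Suc k)) (- j) = v (Suc k) ^^ Suc (nat (- j - 1))"
        using 2 by (simp add: ipow_def Suc_nat_eq_nat_zadd1 del: funpow.simps)
      moreover have "ipow (v (Suc k)) (- j) s = t" by (simp add: s_def ipow_add[OF pv])
      ultimately show False using dis[of k s "nat (- j - 1)"] t j by (simp add: s_def)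
    qed
  qed
qed (auto intro: L vL)

text \<open>A point that \<open>v (Suc k)\<close> fixes is not displaced, so \<open>v k\<close>
  cannot move it. This confines the image of \<open>emb v (Suc k)\<close> to the support of
  \<open>v (Suc k)\<close>.\<close>

lemma support_grows: "v k t \<noteq> t \<Longrightarrow> v (Suc k) t \<noteq> t"
  using dis[of k t 0] by auto

lemma support_nonempty: "\<exists>t. v k t \<noteq> t"
proof (induction k)
  case 0
  then show ?case using v0 by (auto simp: fun_eq_iff)
qed (use support_grows in blast)

text \<open>The clauses go through the induction together: the unit clause turns finite support into
  finitely many nontrivial factors, the support clause makes the factors act inside their
  translates, and injectivity is inherited factor by factor.\<close>

lemma emb_props:
  "\<one>\<^bsub>Wgrp k\<^esub> \<in> carrier (Wgrp k) \<and> emb v k \<one>\<^bsub>Wgrp k\<^esub> = id \<and>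
   (\<forall>w\<in>carrier (Wgrp k). emb v k w \<in> L \<and> (\<forall>t. v k t = t \<longrightarrow> emb v k w t = t)) \<and>
   (\<forall>w\<in>carrier (Wgrp k). \<forall>w'\<in>carrier (Wgrp k). emb v k (w \<otimes>\<^bsub>Wgrp k\<^esub> w') = emb v k w' \<circ> emb v k w) \<and>
   inj_on (emb v k) (carrier (Wgrp k))"
proof (induction k)
  case 0
  have inj: "inj_on (emb v 0) (carrier (Wgrp 0))"
  proof (rule inj_onI)
    fix w w' assume w: "w \<in> carrier (Wgrp 0)" and w': "w' \<in> carrier (Wgrp 0)" and eq: "emb v 0 w = emb v 0 w'"
    obtain a b where ab: "w = WBase a" "w' = WBase b" using w w' by (auto simp: Zgrp_def)
    have main: "\<not> a < b" if eq: "ipow (v 0) a = ipow (v 0) b" for a b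
    proof
      assume "a < b"
      obtain t where t: "v 0 t \<noteq> t" using support_nonempty by blast
      have "ipow (v 0) (- a) (ipow (v 0) b t) = ipow (v 0) (- a) (ipow (v 0) a t)" using eq by simp
      then have "ipow (v 0) (b - a) t = t" by (simp add: ipow_add[OF pv])
      moreover have "ipow (v 0) (b - a) = v 0 ^^ Suc (nat (b - a - 1))"
        using \<open>a < b\<close> by (simp add: ipow_def Suc_nat_eq_nat_zadd1 del: funpow.simps)
      ultimately show False using funpow_fixpoint[OF pv] t by metis
    qed
    have "ipow (v 0) a = ipow (v 0) b" using eq ab by simp
    then have "a = b" using main[of a b] main[of b a] by simp
    then show "w = w'" using ab by simp
  qed
  have "ipow (v 0) (a + b) = ipow (v 0) b \<circ> ipow (v 0) a" for a b
    by (auto simp: fun_eq_iff ipow_add[OF pv] add.commute)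
  then show ?case
    using ipow_in[OF L vL] ipow_fixpoint[OF pv]
    by (intro conjI inj) (auto simp: Zgrp_def)
next
  case (Suc k)
  let ?S = "{t. v k t \<noteq> t}"
  let ?C = "carrier (Wgrp k)"
  interpret displacing L "v (Suc k)" ?S by (rule displacing)
  have one: "\<one>\<^bsub>Wgrp k\<^esub> \<in> ?C" "emb v k \<one>\<^bsub>Wgrp k\<^esub> = id"
    and inL: "\<And>w. w \<in> ?C \<Longrightarrow> emb v k w \<in> L"
    and off: "\<And>w t. w \<in> ?C \<Longrightarrow> t \<notin> ?S \<Longrightarrow> emb v k w t = t"
    and mult: "\<And>w w'. w \<in> ?C \<Longrightarrow> w' \<in> ?C \<Longrightarrow> emb v k (w \<otimes>\<^bsub>Wgrp k\<^esub> w') = emb v k w' \<circ> emb v k w"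
    and inj: "inj_on (emb v k) ?C"
    using Suc.IH by auto
  have on: "emb v k w t \<in> ?S" if "w \<in> ?C" "t \<in> ?S" for w t
  proof (rule ccontr)
    assume "emb v k w t \<notin> ?S"
    then have "emb v k w (emb v k w t) = emb v k w t" by (rule off[OF that(1)])
    then have "emb v k w t = t" using plf_eq[OF plg_plf[OF L inL[OF that(1)]]] by blast
    then show False using \<open>emb v k w t \<notin> ?S\<close> that(2) by simp
  qed
  let ?b = "\<lambda>f. base (v (Suc k)) ?S (\<lambda>j. emb v k (f j))"
  have carr: "\<exists>f n. w = WPair f n \<and> (\<forall>i. f i \<in> ?C) \<and> finite {i. f i \<noteq> \<one>\<^bsub>Wgrp k\<^esub>}"
    if "w \<in> carrier (Wgrp (Suc k))" for w
    using that by (auto simp: wrZ_def)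
  have e: "emb v (Suc k) (WPair f n) = ipow (v (Suc k)) n \<circ> ?b f" for f n by simp
  have 1: "\<one>\<^bsub>Wgrp (Suc k)\<^esub> \<in> carrier (Wgrp (Suc k))" using one by (auto simp: wrZ_def)
  have 2: "emb v (Suc k) \<one>\<^bsub>Wgrp (Suc k)\<^esub> = id" using one base_id by (simp add: wrZ_def)
  have 3: "emb v (Suc k) w \<in> L" if "w \<in> carrier (Wgrp (Suc k))" for w
  proof -
    obtain f n where w: "w = WPair f n" "\<And>i. f i \<in> ?C" "finite {i. f i \<noteq> \<one>\<^bsub>Wgrp k\<^esub>}"
      using carr[OF \<open>w \<in> carrier (Wgrp (Suc k))\<close>] by auto
    have "{j. emb v k (f j) \<noteq> id} \<subseteq> {i. f i \<noteq> \<one>\<^bsub>Wgrp k\<^esub>}" using one by auto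
    then have "?b f \<in> L" by (rule base_in[OF w(3)]) (use w(2) inL off on in blast)+
    then show ?thesis using w(1) ipow_in[OF L vL] by (simp add: plg_comp[OF L])
  qed
  have 4: "emb v (Suc k) w t = t" if wC: "w \<in> carrier (Wgrp (Suc k))" and t: "v (Suc k) t = t" for w t
  proof -
    obtain f n where w: "w = WPair f n" using carr[OF wC] by auto
    have "t \<notin> ?S" using support_grows t by auto
    then have "?b f t = t" using ipow_fixpoint[OF pv t] by (intro base_off) auto
    then show ?thesis using w ipow_fixpoint[OF pv t] by simp
  qed
  have 5: "emb v (Suc k) (w \<otimes>\<^bsub>Wgrp (Suc k)\<^esub> w') = emb v (Suc k) w' \<circ> emb v (Suc k) w"
    if w: "w \<in> carrier (Wgrp (Suc k))" and w': "w' \<in> carrier (Wgrp (Suc k))" for w w'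
  proof -
    obtain f n where f: "w = WPair f n" "\<And>i. f i \<in> ?C" using carr[OF w] by auto
    obtain g m where g: "w' = WPair g m" "\<And>i. g i \<in> ?C" using carr[OF w'] by auto
    have "w \<otimes>\<^bsub>Wgrp (Suc k)\<^esub> w' = WPair (\<lambda>i. f i \<otimes>\<^bsub>Wgrp k\<^esub> g (i - n)) (n + m)"
      using f g by (simp add: wrZ_def)
    then have "emb v (Suc k) (w \<otimes>\<^bsub>Wgrp (Suc k)\<^esub> w') =
      ipow (v (Suc k)) (n + m) \<circ> base (v (Suc k)) ?S (\<lambda>i. emb v k (g (i - n)) \<circ> emb v k (f i))"
      using mult f g by simp
    also have "base (v (Suc k)) ?S (\<lambda>i. emb v k (g (i - n)) \<circ> emb v k (f i)) =
      base (v (Suc k)) ?S (\<lambda>i. emb v k (g (i - n))) \<circ> ?b f"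
      by (rule base_comp) (use on f in blast)
    also have "base (v (Suc k)) ?S (\<lambda>i. emb v k (g (i - n))) = ipow (v (Suc k)) (- n) \<circ> ?b g \<circ> ipow (v (Suc k)) n"
      by (rule base_shift)
    finally show ?thesis using f g by (simp add: fun_eq_iff ipow_add[OF pv])
  qed
  have 6: "inj_on (emb v (Suc k)) (carrier (Wgrp (Suc k)))"
  proof (rule inj_onI)
    fix w w' assume w: "w \<in> carrier (Wgrp (Suc k))" and w': "w' \<in> carrier (Wgrp (Suc k))"
      and eq: "emb v (Suc k) w = emb v (Suc k) w'"
    obtain f n where f: "w = WPair f n" "\<And>i. f i \<in> ?C" using carr[OF w] by auto
    obtain g m where g: "w' = WPair g m" "\<And>i. g i \<in> ?C" using carr[OF w'] by auto
    have eq': "ipow (v (Suc k)) n (?b f t) = ipow (v (Suc k)) m (?b g t)" for t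
      using fun_cong[OF eq, of t] f g by simp
    \<comment> \<open>Both base parts keep a point of the support of \<open>v k\<close> inside that
      support, so disjointness of the translates forces equal exponents. Each factor is then
      recovered on its own translate.\<close>
    obtain t where t: "t \<in> ?S" using support_nonempty by blast
    have bt: "?b h t = emb v k (h 0) t" for h using base_on[OF t, of _ 0] by simp
    have s: "?b f t \<in> ?S" "?b g t \<in> ?S" unfolding bt using on f g t by blast+
    have "ipow (v (Suc k)) (- m) (ipow (v (Suc k)) n (?b f t)) = ?b g t"
      unfolding eq' by (simp add: ipow_add[OF pv])
    then have "ipow (v (Suc k)) (n - m) (?b f t) \<in> ?S" using s by (simp add: ipow_add[OF pv])
    then have "n = m" using disj[OF s(1)] by force
    have ipi: "ipow (v (Suc k)) i x = ipow (v (Suc k)) i y \<longleftrightarrow> x = y" for i x y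
      using plf_eq[OF plg_plf[OF L ipow_in[OF L vL]]] .
    have "f j = g j" for j
    proof -
      have "emb v k (f j) s = emb v k (g j) s" for s
      proof (cases "s \<in> ?S")
        case True
        have "?b f (ipow (v (Suc k)) (- j) s) = ?b g (ipow (v (Suc k)) (- j) s)"
          using eq' \<open>n = m\<close> ipi by blast
        then show ?thesis using base_on[OF True] ipi by metis
      qed (use off f g in metis)
      then show ?thesis using inj f g by (meson ext inj_onD)
    qed
    then show "w = w'" using f g \<open>n = m\<close> by auto
  qed
  show ?case using 1 2 3 4 5 6 by blast
qed

lemma emb_compatible:
  assumes w: "w \<in> carrier (Wgrp k)"
  shows "emb v (Suc k) (wr_emb k w) = emb v k w"
proof -
  interpret displacing L "v (Suc k)" "{t. v k t \<noteq> t}" by (rule displacing)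
  have "(\<lambda>j. emb v k (if j = 0 then w else \<one>\<^bsub>Wgrp k\<^esub>)) = (\<lambda>j. if j = 0 then emb v k w else id)"
    using emb_props[of k] by auto
  then have "base (v (Suc k)) {t. v k t \<noteq> t} (\<lambda>j. emb v k (if j = 0 then w else \<one>\<^bsub>Wgrp k\<^esub>)) =
      base (v (Suc k)) {t. v k t \<noteq> t} (\<lambda>j. if j = 0 then emb v k w else id)"
    by (rule arg_cong)
  then have "emb v (Suc k) (wr_emb k w) = base (v (Suc k)) {t. v k t \<noteq> t} (\<lambda>j. if j = 0 then emb v k w else id)"
    unfolding wr_emb_def emb.simps wr.case ipow_0 id_o .
  also have "\<dots> = emb v k w"
    using base_single[of "emb v k w" 0] emb_props[of k] w by simp
  finally show ?thesis .
qed

lemma contains: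
  assumes "L \<subseteq> H" "H \<subseteq> carrier PLo"
  shows "contains_Zwr_infty H"
  unfolding contains_Zwr_infty_def
proof (intro exI[of _ "emb v"] allI conjI)
  fix k
  show "emb v k \<in> hom (Wgrp k) PLo"
    using emb_props[of k] assms by (auto simp: hom_def PLo_def)
  show "inj_on (emb v k) (carrier (Wgrp k))" using emb_props by blast
  show "emb v k ` carrier (Wgrp k) \<subseteq> H" using emb_props[of k] assms by blast
  show "\<forall>w\<in>carrier (Wgrp k). emb v (Suc k) (wr_emb k w) = emb v k w"
    using emb_compatible by blast
qed

end


subsection \<open>Subgroups of the group of piecewise linear homeomorphisms\<close>

lemma pl_homeo_strict_mono:
  assumes f: "pl_homeo f" shows "strict_mono f"
proof (rule strict_monoI)
  fix x y :: real assume xy: "x < y"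
  have out: "f z = z" if "z \<notin> {0..1}" for z using f that by (auto simp: pl_homeo_def)
  have m: "f a < f b" if "a \<in> {0..1}" "b \<in> {0..1}" "a < b" for a b
    using f that unfolding pl_homeo_def by (meson strict_mono_onD)
  have rng: "0 \<le> f z \<and> f z \<le> 1" if "z \<in> {0..1}" for z
    using m[of 0 z] m[of z 1] that f unfolding pl_homeo_def by (cases "z = 0"; cases "z = 1") auto
  show "f x < f y"
    using m[of x y] rng[of x] rng[of y] out[of x] out[of y] xy
    by (cases "x \<in> {0..1}"; cases "y \<in> {0..1}") auto
qed

lemma pl_homeo_surj:
  assumes f: "pl_homeo f" shows "surj f" "f ` {0..1} = {0..1}"
proof -
  have c: "continuous_on {0..1} f" "f 0 = 0" "f 1 = 1" and out: "\<And>z. z \<notin> {0..1} \<Longrightarrow> f z = z"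
    using f by (auto simp: pl_homeo_def)
  note mono = strict_mono_less_eq[OF pl_homeo_strict_mono[OF f]]
  have iv: "y \<in> f ` {0..1}" if "y \<in> {0..1}" for y
    using IVT'[of f 0 y 1] c that by force
  show "f ` {0..1} = {0..1}" using iv mono[of 0] mono[of _ 1] c by auto
  have "\<exists>x. y = f x" for y
  proof (cases "y \<in> {0..1}")
    case False
    then show ?thesis using out by (intro exI[of _ y]) simp
  qed (use iv in blast)
  then show "surj f" by (auto simp: surj_def)
qed

lemma pl_homeo_linear_pieces:
  assumes "pl_homeo f"
  obtains P where "finite P" "0 \<in> P" "1 \<in> P"
    "\<forall>a\<in>P. \<forall>b\<in>P. a < b \<longrightarrow> (\<forall>p\<in>P. \<not> (a < p \<and> p < b)) \<longrightarrow> (\<exists>m c. \<forall>x\<in>{a..b}. f x = m * x + c)"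
proof -
  obtain P where P: "finite P" "{0, 1} \<subseteq> P"
    "\<forall>a\<in>P. \<forall>b\<in>P. a < b \<and> {a<..<b} \<inter> P = {} \<longrightarrow> (\<exists>m c. \<forall>x\<in>{a..b}. f x = m * x + c)"
    using assms unfolding pl_homeo_def by blast
  have "{a<..<b} \<inter> P = {}" if "\<forall>p\<in>P. \<not> (a < p \<and> p < b)" for a b using that by auto
  then have "\<forall>a\<in>P. \<forall>b\<in>P. a < b \<longrightarrow> (\<forall>p\<in>P. \<not> (a < p \<and> p < b)) \<longrightarrow> (\<exists>m c. \<forall>x\<in>{a..b}. f x = m * x + c)"
    using P(3) by presburger
  then show thesis using that[OF P(1)] P(2) by simp
qed

lemma pl_homeo_plf:
  assumes f: "pl_homeo f" shows "plf f"
proof -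
  have f01: "continuous_on {0..1} f" "f 0 = 0" "f 1 = 1" and out: "\<And>z. z \<notin> {0..1} \<Longrightarrow> f z = z"
    using f by (auto simp: pl_homeo_def)
  then have out': "f z = z" if "z \<le> 0 \<or> 1 \<le> z" for z
    using that by (cases "z = 0"; cases "z = 1") auto
  obtain P where P: "finite P" "0 \<in> P" "1 \<in> P"
    and lin: "\<forall>a\<in>P. \<forall>b\<in>P. a < b \<longrightarrow> (\<forall>p\<in>P. \<not> (a < p \<and> p < b)) \<longrightarrow>
       (\<exists>m c. \<forall>x\<in>{a..b}. f x = m * x + c)"
    by (rule pl_homeo_linear_pieces[OF f]) (rule that)
  have "continuous_on ({..0} \<union> ({0..1} \<union> {1..})) f"
  proof (intro continuous_on_closed_Un f01 closed_Un)
    show "continuous_on {..0} f" "continuous_on {1..} f"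
      using out' by (auto intro: continuous_on_eq[OF continuous_on_id])
  qed auto
  moreover have "{..0} \<union> ({0..1} \<union> {1..}) = (UNIV :: real set)" by auto
  ultimately have cont: "continuous_on UNIV f" by simp
  have right: "\<exists>m. \<forall>\<^sub>F x in at_right t. f x = f t + m * (x - t)" for t
  proof (cases "0 \<le> t \<and> t < 1")
    case True
    \<comment> \<open>The neighbouring partition points bracket \<open>t\<close> with
      \<open>t < b\<close>, so one affine piece covers a right neighbourhood of
      \<open>t\<close>.\<close>
    define a where "a = Max {p \<in> P. p \<le> t}"
    define b where "b = Min {p \<in> P. t < p}"
    have fin: "finite {p \<in> P. p \<le> t}" "finite {p \<in> P. t < p}" using P by auto
    have "{p \<in> P. p \<le> t} \<noteq> {}" "{p \<in> P. t < p} \<noteq> {}" using True P(2,3) by auto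
    then have "a \<in> {p \<in> P. p \<le> t}" "b \<in> {p \<in> P. t < p}"
      unfolding a_def b_def using Max_in[OF fin(1)] Min_in[OF fin(2)] by blast+
    then have a: "a \<in> P" "a \<le> t" and b: "b \<in> P" "t < b" by simp_all
    have "\<not> (a < p \<and> p < b)" if p: "p \<in> P" for p
      using Max_ge[OF fin(1), of p] Min_le[OF fin(2), of p] p unfolding a_def b_def
      by (cases "p \<le> t") auto
    moreover have "a < b" using a b by simp
    ultimately obtain m c where mc: "\<forall>x\<in>{a..b}. f x = m * x + c" using lin a(1) b(1) by blast
    have "\<forall>\<^sub>F x in at_right t. f x = f t + m * (x - t)"
      unfolding eventually_at_right_field
      using b(2) mc a b by (intro exI[of _ b]) (auto simp: algebra_simps)
    then show ?thesis by blast
  next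
    case False
    then consider "t < 0" | "1 \<le> t" by linarith
    then have "\<forall>\<^sub>F x in at_right t. f x = f t + 1 * (x - t)"
    proof cases
      case 1
      then show ?thesis unfolding eventually_at_right_field
        by (intro exI[of _ 0]) (auto simp: out')
    next
      case 2
      then show ?thesis unfolding eventually_at_right_field
        by (intro exI[of _ "t + 1"]) (auto simp: out')
    qed
    then show ?thesis by blast
  qed
  have left: "\<exists>m. \<forall>\<^sub>F x in at_left t. f x = f t + m * (x - t)" for t
  proof (cases "0 < t \<and> t \<le> 1")
    case True
    define a where "a = Max {p \<in> P. p < t}"
    define b where "b = Min {p \<in> P. t \<le> p}"
    have fin: "finite {p \<in> P. p < t}" "finite {p \<in> P. t \<le> p}" using P by auto
    have "{p \<in> P. p < t} \<noteq> {}" "{p \<in> P. t \<le> p} \<noteq> {}" using True P(2,3) by auto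
    then have "a \<in> {p \<in> P. p < t}" "b \<in> {p \<in> P. t \<le> p}"
      unfolding a_def b_def using Max_in[OF fin(1)] Min_in[OF fin(2)] by blast+
    then have a: "a \<in> P" "a < t" and b: "b \<in> P" "t \<le> b" by simp_all
    have "\<not> (a < p \<and> p < b)" if p: "p \<in> P" for p
      using Max_ge[OF fin(1), of p] Min_le[OF fin(2), of p] p unfolding a_def b_def
      by (cases "p < t") auto
    moreover have "a < b" using a b by simp
    ultimately obtain m c where mc: "\<forall>x\<in>{a..b}. f x = m * x + c" using lin a(1) b(1) by blast
    have "\<forall>\<^sub>F x in at_left t. f x = f t + m * (x - t)"
      unfolding eventually_at_left_field
      using a(2) mc a b by (intro exI[of _ a]) (auto simp: algebra_simps)
    then show ?thesis by blast
  next
    case False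
    then consider "t \<le> 0" | "1 < t" by linarith
    then have "\<forall>\<^sub>F x in at_left t. f x = f t + 1 * (x - t)"
    proof cases
      case 1
      then show ?thesis unfolding eventually_at_left_field
        by (intro exI[of _ "t - 1"]) (auto simp: out')
    next
      case 2
      then show ?thesis unfolding eventually_at_left_field
        by (intro exI[of _ 1]) (auto simp: out')
    qed
    then show ?thesis by blast
  qed
  have "f x = x" if "x \<notin> {0<..<1}" for x using out' that by auto
  then show ?thesis
    unfolding plf_def using pl_homeo_strict_mono[OF f] pl_homeo_surj(1)[OF f] cont right left by blast
qed

lemma pl_homeo_finv:
  assumes f: "pl_homeo f" shows "pl_homeo (finv f)"
proof -
  note pf = pl_homeo_plf[OF f]
  have f01: "continuous_on {0..1} f" "f 0 = 0" "f 1 = 1" and out: "\<And>z. z \<notin> {0..1} \<Longrightarrow> f z = z"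
    using f by (auto simp: pl_homeo_def)
  obtain P where P: "finite P" "{0, 1} \<subseteq> P" "P \<subseteq> {0..1}"
    "\<forall>a\<in>P. \<forall>b\<in>P. a < b \<and> {a<..<b} \<inter> P = {} \<longrightarrow> (\<exists>m c. \<forall>x\<in>{a..b}. f x = m * x + c)"
    using f unfolding pl_homeo_def by blast
  have "continuous_on (f ` {0..1}) (finv f)"
    using f01 by (intro continuous_on_inv) (auto simp: plf_finv1[OF pf])
  then have c: "continuous_on {0..1} (finv f)" using pl_homeo_surj(2)[OF f] by simp
  have m: "strict_mono_on {0..1} (finv f)"
    by (rule strict_mono_onI) (simp add: finv_less[OF pf] plf_finv2[OF pf])
  have o: "finv f 0 = 0" "finv f 1 = 1" "\<forall>x. x \<notin> {0..1} \<longrightarrow> finv f x = x"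
    using f01 out by (simp_all add: finv_fixpoint[OF pf])
  have "0 \<in> f ` P" "1 \<in> f ` P" using P(2) f01(2,3) by (metis image_eqI insert_subset)+
  then have e: "{0, 1} \<subseteq> f ` P" by simp
  have r: "f ` P \<subseteq> {0..1}" using P pl_homeo_surj(2)[OF f] by blast
  have l: "\<exists>m c. \<forall>x\<in>{a'..b'}. finv f x = m * x + c"
    if ab': "a' \<in> f ` P" "b' \<in> f ` P" "a' < b' \<and> {a'<..<b'} \<inter> f ` P = {}" for a' b'
  proof -
    obtain a b where ab: "a \<in> P" "b \<in> P" "a' = f a" "b' = f b" using ab' by blast
    have "a < b" using ab' ab plf_less[OF pf] by simp
    moreover have "{a<..<b} \<inter> P = {}"
    proof (rule ccontr)
      assume "{a<..<b} \<inter> P \<noteq> {}"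
      then obtain p where "p \<in> P" "a < p" "p < b" by auto
      then have "f p \<in> {a'<..<b'} \<inter> f ` P" using ab plf_less[OF pf] by simp
      then show False using ab' by blast
    qed
    ultimately obtain m c where mc: "\<And>x. x \<in> {a..b} \<Longrightarrow> f x = m * x + c" using P(4) ab by blast
    have "f a < f b" using ab ab' by simp
    then have "m \<noteq> 0" using mc[of a] mc[of b] \<open>a < b\<close> by auto
    have "finv f y = (1 / m) * y + (- c / m)" if y: "y \<in> {a'..b'}" for y
    proof -
      have "finv f y \<in> {a..b}"
        using y ab less_finv[OF pf, of b y] finv_less[OF pf, of y a] by (auto simp: not_less[symmetric])
      then have "y = m * finv f y + c" using mc plf_finv2[OF pf] by metis
      then show ?thesis using \<open>m \<noteq> 0\<close> by (simp add: field_simps)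
    qed
    then show ?thesis by blast
  qed
  show ?thesis unfolding pl_homeo_def
    by (intro conjI exI[of _ "f ` P"] ballI impI c m o e r l finite_imageI P(1)) simp_all
qed

lemma subgroup_plg:
  assumes H: "subgroup H PLo" shows "plg H" "H \<subseteq> carrier PLo"
proof -
  show sub: "H \<subseteq> carrier PLo" using subgroup.subset[OF H] .
  have plH: "pl_homeo f" if "f \<in> H" for f using sub that by (auto simp: PLo_def)
  have "finv f \<in> H" if fH: "f \<in> H" for f
  proof -
    note pf = pl_homeo_plf[OF plH[OF fH]]
    \<comment> \<open>\<open>m_inv\<close> is a definite description over the carrier: the inverse
      must be shown to lie there, by \<open>pl_homeo_finv\<close>, and to be unique.\<close>
    have "m_inv PLo f = finv f" unfolding m_inv_def
    proof (rule the_equality)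
      show "finv f \<in> carrier PLo \<and> f \<otimes>\<^bsub>PLo\<^esub> finv f = \<one>\<^bsub>PLo\<^esub> \<and> finv f \<otimes>\<^bsub>PLo\<^esub> f = \<one>\<^bsub>PLo\<^esub>"
        using pl_homeo_finv[OF plH[OF fH]] by (auto simp: PLo_def fun_eq_iff plf_finv1[OF pf] plf_finv2[OF pf])
      fix y assume "y \<in> carrier PLo \<and> f \<otimes>\<^bsub>PLo\<^esub> y = \<one>\<^bsub>PLo\<^esub> \<and> y \<otimes>\<^bsub>PLo\<^esub> f = \<one>\<^bsub>PLo\<^esub>"
      then have "f (y t) = t" for t by (auto simp: PLo_def fun_eq_iff)
      then show "y = finv f" using plf_finv1[OF pf] by (metis ext)
    qed
    then show ?thesis using subgroup.m_inv_closed[OF H fH] by simp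
  qed
  moreover have "id \<in> H" using subgroup.one_closed[OF H] by (simp add: PLo_def)
  \<comment> \<open>The factors are swapped because the product of \<open>PLo\<close> is read from
    left to right.\<close>
  moreover have "f \<circ> g \<in> H" if "f \<in> H" "g \<in> H" for f g
    using subgroup.m_closed[OF H that(2,1)] by (simp add: PLo_def)
  ultimately show "plg H" using plH pl_homeo_plf by (auto simp: plg_def)
qed

section \<open>Generated subgroups and towers\<close>

inductive_set gen :: "(real \<Rightarrow> real) set \<Rightarrow> (real \<Rightarrow> real) set" for X where
  gen_id: "id \<in> gen X"
| gen_base: "f \<in> X \<Longrightarrow> f \<in> gen X"
| gen_inv: "f \<in> gen X \<Longrightarrow> finv f \<in> gen X"
| gen_comp: "f \<in> gen X \<Longrightarrow> g \<in> gen X \<Longrightarrow> f \<circ> g \<in> gen X"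

lemma gen_subset:
  assumes "plg H" "X \<subseteq> H" shows "gen X \<subseteq> H"
proof
  fix f assume "f \<in> gen X" then show "f \<in> H"
  proof induction
    case gen_id
    show ?case by (rule plg_id[OF assms(1)])
  next
    case (gen_inv f)
    show ?case by (rule plg_inv[OF assms(1) gen_inv.IH])
  next
    case (gen_comp f g)
    show ?case by (rule plg_comp[OF assms(1) gen_comp.IH])
  qed (use assms(2) in blast)
qed

lemma plg_gen:
  assumes "plg H" "X \<subseteq> H" shows "plg (gen X)"
  using gen_subset[OF assms] plg_plf[OF assms(1)] by (auto simp: plg_def intro: gen.intros)

lemma gen_fixes:
  assumes "plg H" "X \<subseteq> H" "\<And>g. g \<in> X \<Longrightarrow> g t = t" "f \<in> gen X"
  shows "f t = t"
  using assms(4)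
proof induction
  case (gen_inv f)
  then have "plf f" using gen_subset[OF assms(1,2)] plg_plf[OF assms(1)] by blast
  then show ?case using gen_inv finv_fixpoint by blast
qed (use assms(3) in auto)

text \<open>For a tower the core acts without fixed points on the orbital of the generated group,
  because each orbital is an orbital of an element with a fixed point in a larger orbital.\<close>
lemma core_full:
  assumes H: "plg H" "X \<subseteq> H" and pl: "is_orbital (gen X) a b"
    and e: "\<And>g. g \<in> X \<Longrightarrow> \<exists>e. a < e \<and> e < b \<and> g e = e"
  shows "is_orbital (core (gen X)) a b"
proof (rule ccontr)
  assume "\<not> ?thesis"
  then obtain z where z: "a < z" "z < b" "z \<in> fixed (core (gen X))" using orbital_core_iff[OF pl] by blast
  have "g z = z" if g: "g \<in> X" for g
  proof -
    obtain e where "a < e" "e < b" "g e = e" using assms(4)[OF g] by blast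
    then show ?thesis using fixpoint_spreads[OF plg_gen[OF H] pl z gen_base[OF g] _ _ _ z] by blast
  qed
  then have "z \<in> fixed (gen X)" using gen_fixes[OF H] by (auto simp: fixed_def)
  then show False using pl z by (auto simp: is_orbital_def)
qed

theorem theorem7:
  assumes "subgroup H PLo"
    and "\<exists>T. tower H T \<and> tall T"
  shows "contains_Zwr_infty H"
proof -
  note H = subgroup_plg[OF assms(1)]
  obtain T where T: "tower H T" "tall T" using assms(2) by blast
  then obtain s :: "nat \<Rightarrow> real set \<times> (real \<Rightarrow> real)"
    where s: "\<forall>n. s n \<in> T" "inj s" "\<forall>m n. m \<le> n \<longrightarrow> fst (s m) \<subseteq> fst (s n)"
    unfolding tall_def by blast
  define A where "A n = fst (s n)" for n
  define g where "g n = snd (s n)" for n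
  have A: "A n \<in> components (moved (g n))" and gH: "g n \<in> H" for n
    using T(1) s(1) by (auto simp: tower_def signed_orbital_def orbitals_def A_def g_def)
  have Amov: "x \<in> {0..1} \<and> g n x \<noteq> x" if "x \<in> A n" for n x
    using in_components_subset[OF A] that by (auto simp: moved_def)
  have conn: "connected (A n)" for n using in_components_connected[OF A] .
  have mono: "A m \<subseteq> A n" if "m \<le> n" for m n using s(3) that by (simp add: A_def)
  have neq: "A n \<noteq> A (Suc n)" for n
  proof -
    have "s n \<noteq> s (Suc n)" using s(2) by (metis injD n_not_Suc_n)
    then show ?thesis using T(1) s(1) unfolding tower_def A_def by blast
  qed
  \<comment> \<open>Other elements of \<open>H\<close> need not have a fixed point in the orbital,
    hence the restriction to the generated subgroup.\<close>
  define L where "L = gen (range g)"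
  have X: "range g \<subseteq> H" using gH by auto
  have L: "plg L" unfolding L_def by (rule plg_gen[OF H(1) X])
  have gL: "g n \<in> L" for n unfolding L_def by (intro gen_base) simp
  obtain q where q: "q \<in> A 0" using in_components_nonempty[OF A] by blast
  have qA: "q \<in> A n" for n using mono[of 0 n] q by auto
  have "q \<notin> fixed L" using Amov[OF q] gL[of 0] by (auto simp: fixed_def)
  then obtain a b where ab: "is_orbital L a b" "a < q" "q < b" using orbital_exists plg_plf[OF L] by metis
  have Aab: "a < x \<and> x < b" if x: "x \<in> A n" for n x
  proof -
    have "g n a = a" "g n b = b" using ab gL by (auto simp: is_orbital_def fixed_def)
    then have "a \<notin> A n" "b \<notin> A n" using Amov by blast+
    then show ?thesis
      using connectedD_interval[OF conn x qA, of a] connectedD_interval[OF conn qA x, of b] ab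
      by (meson less_imp_le not_less)
  qed
  have fp: "\<exists>e. a < e \<and> e < b \<and> g n e = e" for n
  proof -
    \<comment> \<open>Otherwise \<open>A (Suc n)\<close> would be a connected set of points moved by
      \<open>g n\<close>, and maximality of the component \<open>A n\<close> would make the two
      equal.\<close>
    have "\<exists>e\<in>A (Suc n). g n e = e"
    proof (rule ccontr)
      assume "\<not> ?thesis"
      then have "A (Suc n) \<subseteq> moved (g n)" using Amov by (auto simp: moved_def)
      then have "A (Suc n) \<subseteq> A n" using components_maximal[OF A conn] qA by blast
      then show False using mono[of n "Suc n"] neq[of n] by auto
    qed
    then show ?thesis using Aab by blast
  qed
  have "is_orbital (core L) a b"
    using core_full[OF H(1) X, folded L_def, OF ab(1)] fp by auto
  then obtain v0 where v0: "v0 \<in> thin L" "v0 q \<noteq> q" using thin_moves[OF L ab(1) _ ab(2,3)] by blast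
  note G = plg_thin[OF L] and cG = core_thin[OF L]
  \<comment> \<open>Nontriviality is demanded at 0 only; \<open>support_grows\<close> passes it on
    to all later terms.\<close>
  have "\<exists>v. \<forall>n. (v n \<in> thin L \<and> (n = 0 \<longrightarrow> v n \<noteq> id)) \<and>
      (\<forall>m t. v n t \<noteq> t \<longrightarrow> v n ((v (Suc n) ^^ Suc m) t) = (v (Suc n) ^^ Suc m) t)"
  proof (rule dependent_nat_choice)
    show "\<exists>x. x \<in> thin L \<and> (0 = (0::nat) \<longrightarrow> x \<noteq> id)" using v0 by (intro exI[of _ v0]) auto
  next
    fix x and n :: nat assume x: "x \<in> thin L \<and> (n = 0 \<longrightarrow> x \<noteq> id)"
    then have "x \<in> thin L" by simp
    then obtain w where "w \<in> thin L" "\<And>n t. x t \<noteq> t \<Longrightarrow> x ((w ^^ Suc n) t) = (w ^^ Suc n) t"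
      by (rule next_generator[OF G cG]) (rule that)
    then show "\<exists>y. (y \<in> thin L \<and> (Suc n = 0 \<longrightarrow> y \<noteq> id)) \<and>
        (\<forall>m t. x t \<noteq> t \<longrightarrow> x ((y ^^ Suc m) t) = (y ^^ Suc m) t)"
      by (intro exI[of _ w]) blast
  qed
  then obtain v where v: "\<And>n. v n \<in> thin L" "v 0 \<noteq> id"
    "\<And>n m t. v n t \<noteq> t \<Longrightarrow> v n ((v (Suc n) ^^ Suc m) t) = (v (Suc n) ^^ Suc m) t" by blast
  interpret nested_displacement "thin L" v
    by standard (use G v in blast)+
  have "thin L \<subseteq> H"
    using gen_subset[OF H(1) X] unfolding L_def thin_def core_def by blast
  then show ?thesis using contains H(2) by blast
qed

end
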